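(* (1) Let $X$ be a finite CW-complex, let $\omega$ be a continuous closed 1-form on $X$, and let $\xi=[\omega]\in H^1(X;\mathbf{R})$. Suppose that $\omega$ has finitely many zero points $p_1,\dots,p_k$. If $k<\operatorname{cat}(X,\xi)$, then any gradient-like flow of $\omega$ whose only fixed points are $p_1,\dots,p_k$ has a homoclinic cycle. (2) Let $\omega$ be a continuous closed 1-form on a finite CW-complex $X$ representing $\xi\in H^1(X;\mathbf{R})$. If $\omega$ admits a gradient-like flow with no homoclinic cycles, then $\omega$ has at least $\operatorname{cat}(X,\xi)$ distinct zero points.
   Context: Continuous closed 1-form: a continuous closed 1-form $\omega$ on a topological space $X$ is a collection $\{f_U\}_{U\in\mathcal U}$ of continuous functions $f_U:U\to\mathbf{R}$, where $\mathcal U$ is an open cover of $X$, such that for all $U,V\in\mathcal U$ the function $f_U|_{U\cap V}-f_V|_{U\cap V}$ is locally constant on $U\cap V$. Two such forms $\{f_U\}_{U\in\mathcal U}$ and $\{g_V\}_{V\in\mathcal V}$ are equivalent if their union $\{f_U,g_V\}_{U\in\mathcal U,V\in\mathcal V}$ is again a continuous closed 1-form. Integral: for a continuous path $\gamma:[0,1]\to X$, choose a subdivision $0=t_0<t_1<\dots<t_N=1$ such that each $\gamma([t_i,t_{i+1}])$ lies in a single $U_i\in\mathcal U$, and put $\int_\gamma\omega=\sum_{i=0}^{N-1}[f_{U_i}(\gamma(t_{i+1}))-f_{U_i}(\gamma(t_i))]$; this is independent of choices and depends only on the homotopy class of $\gamma$ relative to its endpoints. The cohomology class $[\omega]\in H^1(X;\mathbf{R})=\operatorname{Hom}(H_1(X;\mathbf{Z}),\mathbf{R})$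 is the one given by the homomorphism of periods $[\gamma]\mapsto\int_\gamma\omega$; one says $\omega$ represents $[\omega]$. Flows: a continuous flow on $X$ is a continuous map $\varphi:X\times\mathbf{R}\to X$ with $\varphi(x,0)=x$ and $\varphi(\varphi(x,s),t)=\varphi(x,s+t)$; write $\varphi^t(x)=x\cdot t=\varphi(x,t)$. $\operatorname{Fix}(\varphi^t)$ is the set of fixed points, i.e. points $x$ with $x\cdot t=x$ for all $t\in\mathbf{R}$. A gradient-like flow of $\omega=\{f_U\}_{U\in\mathcal U}$ is a continuous flow $\varphi$ on $X$ such that for each $U\in\mathcal U$, on $U-(\operatorname{Fix}(\varphi^t)\cap U)$ the function $f_U$ is a strict Lyapunov function, i.e. $f_U$ is strictly decreasing along (the portions in $U$ of) the non-constant trajectories of the flow. Zero point: a point $p\in X$ is a zero point (zero) of $\omega$ if $p$ is a fixed point of every gradient-like flow of $\omega$. Homoclinic cycle: a homoclinic cycle (of length $n\ge1$) of a flow $\varphi$ is a sequence of non-constant trajectories $\gamma_1,\dots,\gamma_n:\mathbf{R}\to X$, $\gamma_i(t)=x_i\cdot t$, and points $q_1,\dots,q_n$ such that $\lim_{t\to+\infty}\gamma_i(t)=q_{i+1}=\lim_{t\to-\infty}\gamma_{i+1}(t)$ for $i=1,\dots,n-1$ and $\lim_{t\to+\infty}\gamma_n(t)=q_1=\lim_{t\to-\infty}\gamma_1(t)$. Category: for a finite CW-complex $X$ and $\xi\in H^1(X;\mathbf{R})$, $\operatorname{cat}(X,\xi)$ is the least integer $k\ge 0$ such that for every integer $N>0$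 there is an open cover $X=F\cup F_1\cup\dots\cup F_k$ such that (a) each inclusion $F_j\to X$, $j=1,\dots,k$, is null-homotopic; (b) there is a homotopy $h_t:F\to X$, $t\in[0,1]$, with $h_0$ the inclusion $F\to X$, such that for every $x\in F$ one has $\int_{\gamma_x}\omega\le -N$, where $\gamma_x(t)=h_t(x)$ and $\omega$ is a continuous closed 1-form representing $\xi$ (the number does not depend on the choice of $\omega$). The set $F$ may be empty.
   Formalization: In (2) the gradient-like flow with no homoclinic cycles is also required to have exactly the zero points of ω as its fixed points, as in (1); otherwise the constant flow always qualifies and (2) fails, e.g. on (S^1×S^2)#T^3. *)

theory Defs
  imports "HOL-Analysis.Analysis" "HOL-Homology.Homology"
begin

definition closed_disk :: "nat \<Rightarrow> (nat \<Rightarrow> real) set" where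
  "closed_disk n = {x \<in> topspace (Euclidean_space n). (\<Sum>i<n. (x i)\<^sup>2) \<le> 1}"

definition open_disk :: "nat \<Rightarrow> (nat \<Rightarrow> real) set" where
  "open_disk n = {x \<in> topspace (Euclidean_space n). (\<Sum>i<n. (x i)\<^sup>2) < 1}"

definition disk_boundary :: "nat \<Rightarrow> (nat \<Rightarrow> real) set" where
  "disk_boundary n = {x \<in> topspace (Euclidean_space n). (\<Sum>i<n. (x i)\<^sup>2) = 1}"

(* Whitehead's definition. A pair (n, \<Phi>) is an n-cell with characteristic map \<Phi>. For finitely
   many cells, closure finiteness and the weak topology are automatic. *)
definition finite_CW_complex :: "'a topology \<Rightarrow> bool" where
  "finite_CW_complex X \<longleftrightarrow> Hausdorff_space X \<and>
     (\<exists>C :: (nat \<times> ((nat \<Rightarrow> real) \<Rightarrow> 'a)) set. finite C \<and>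
        (\<forall>(n, \<Phi>) \<in> C.
           continuous_map (subtopology (Euclidean_space n) (closed_disk n)) X \<Phi> \<and>
           embedding_map (subtopology (Euclidean_space n) (open_disk n)) X \<Phi> \<and>
           \<Phi> ` disk_boundary n \<subseteq> (\<Union>(m, \<Psi>) \<in> {c \<in> C. fst c < n}. \<Psi> ` open_disk m)) \<and>
        pairwise (\<lambda>(n, \<Phi>) (m, \<Psi>). disjnt (\<Phi> ` open_disk n) (\<Psi> ` open_disk m)) C \<and>
        (\<Union>(n, \<Phi>) \<in> C. \<Phi> ` open_disk n) = topspace X)"

definition locally_constant_on :: "'a topology \<Rightarrow> 'a set \<Rightarrow> ('a \<Rightarrow> real) \<Rightarrow> bool" where
  "locally_constant_on X S f \<longleftrightarrow>
     (\<forall>x\<in>S. \<exists>W. openin (subtopology X S) W \<and> x \<in> W \<and> (\<forall>y\<in>W. f y = f x))"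

(* A family {f_U} is the set of its pairs (U, f_U); the values of f_U outside U are irrelevant. *)
type_synonym 'a one_form = "('a set \<times> ('a \<Rightarrow> real)) set"

definition closed_one_form :: "'a topology \<Rightarrow> 'a one_form \<Rightarrow> bool" where
  "closed_one_form X \<omega> \<longleftrightarrow>
     (\<forall>(U, f) \<in> \<omega>. openin X U \<and> continuous_map (subtopology X U) euclideanreal f) \<and>
     (\<Union>(U, f) \<in> \<omega>. U) = topspace X \<and>
     (\<forall>(U, f) \<in> \<omega>. \<forall>(V, g) \<in> \<omega>. locally_constant_on X (U \<inter> V) (\<lambda>x. f x - g x))"

definition has_path_integral :: "'a one_form \<Rightarrow> (real \<Rightarrow> 'a) \<Rightarrow> real \<Rightarrow> bool" where
  "has_path_integral \<omega> \<gamma> I \<longleftrightarrow>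
     (\<exists>(N :: nat) (t :: nat \<Rightarrow> real) (U :: nat \<Rightarrow> 'a set) (f :: nat \<Rightarrow> 'a \<Rightarrow> real).
        t 0 = 0 \<and> t N = 1 \<and>
        (\<forall>i<N. t i < t (Suc i) \<and> (U i, f i) \<in> \<omega> \<and> \<gamma> ` {t i..t (Suc i)} \<subseteq> U i) \<and>
        I = (\<Sum>i<N. f i (\<gamma> (t (Suc i))) - f i (\<gamma> (t i))))"

definition path_integral :: "'a one_form \<Rightarrow> (real \<Rightarrow> 'a) \<Rightarrow> real" where
  "path_integral \<omega> \<gamma> = (THE I. has_path_integral \<omega> \<gamma> I)"

definition real_additive_group :: "real monoid" where
  "real_additive_group = \<lparr>carrier = UNIV, monoid.mult = (+), one = 0\<rparr>"

definition real_cohomology1 :: "'a topology \<Rightarrow> ('a chain set \<Rightarrow> real) set" where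
  "real_cohomology1 X = hom (homology_group 1 X) real_additive_group"

(* The class of a loop in the first homology group: the standard 1-simplex is identified with
   the unit interval by its coordinate with index 1. *)
definition loop_class :: "'a topology \<Rightarrow> (real \<Rightarrow> 'a) \<Rightarrow> 'a chain set" where
  "loop_class X \<gamma> =
     homologous_rel_set 1 X {} (frag_of (restrict (\<lambda>x. \<gamma> (x 1)) (standard_simplex 1)))"

(* \<xi> is the cohomology class of \<omega>. Loop classes generate the first homology group, so \<xi> is
   determined on its carrier; its values elsewhere are irrelevant. *)
definition represents :: "'a topology \<Rightarrow> 'a one_form \<Rightarrow> ('a chain set \<Rightarrow> real) \<Rightarrow> bool" where
  "represents X \<omega> \<xi> \<longleftrightarrow> \<xi> \<in> real_cohomology1 X \<and>
     (\<forall>\<gamma>. pathin X \<gamma> \<and> \<gamma> 0 = \<gamma> 1 \<longrightarrow> \<xi> (loop_class X \<gamma>) = path_integral \<omega> \<gamma>)"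

definition continuous_flow :: "'a topology \<Rightarrow> ('a \<times> real \<Rightarrow> 'a) \<Rightarrow> bool" where
  "continuous_flow X \<phi> \<longleftrightarrow>
     continuous_map (prod_topology X euclideanreal) X \<phi> \<and>
     (\<forall>x \<in> topspace X. \<phi> (x, 0) = x \<and> (\<forall>s t. \<phi> (\<phi> (x, s), t) = \<phi> (x, s + t)))"

definition fixed_points :: "'a topology \<Rightarrow> ('a \<times> real \<Rightarrow> 'a) \<Rightarrow> 'a set" where
  "fixed_points X \<phi> = {x \<in> topspace X. \<forall>t. \<phi> (x, t) = x}"

definition gradient_like_flow :: "'a topology \<Rightarrow> 'a one_form \<Rightarrow> ('a \<times> real \<Rightarrow> 'a) \<Rightarrow> bool" where
  "gradient_like_flow X \<omega> \<phi> \<longleftrightarrow> continuous_flow X \<phi> \<and>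
     (\<forall>(U, f) \<in> \<omega>. \<forall>x \<in> topspace X - fixed_points X \<phi>. \<forall>s t.
        s < t \<and> (\<forall>r \<in> {s..t}. \<phi> (x, r) \<in> U) \<longrightarrow> f (\<phi> (x, t)) < f (\<phi> (x, s)))"

definition zero_points :: "'a topology \<Rightarrow> 'a one_form \<Rightarrow> 'a set" where
  "zero_points X \<omega> =
     {p \<in> topspace X. \<forall>\<phi>. gradient_like_flow X \<omega> \<phi> \<longrightarrow> p \<in> fixed_points X \<phi>}"

(* The constant flow is gradient-like for every form and has no homoclinic cycles. Hence a
   statement about a gradient-like flow without homoclinic cycles only has content together
   with a condition on its fixed points. *)
lemma gradient_like_flow_fst: "gradient_like_flow X \<omega> fst"
  by (auto simp: gradient_like_flow_def continuous_flow_def fixed_points_def continuous_map_fst)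

definition has_homoclinic_cycle :: "'a topology \<Rightarrow> ('a \<times> real \<Rightarrow> 'a) \<Rightarrow> bool" where
  "has_homoclinic_cycle X \<phi> \<longleftrightarrow>
     (\<exists>(n :: nat) (x :: nat \<Rightarrow> 'a) (q :: nat \<Rightarrow> 'a). n \<ge> 1 \<and>
        (\<forall>i\<in>{1..n}. x i \<in> topspace X - fixed_points X \<phi>) \<and>
        (\<forall>i\<in>{1..<n}. limitin X (\<lambda>t. \<phi> (x i, t)) (q (i + 1)) at_top \<and>
                      limitin X (\<lambda>t. \<phi> (x (i + 1), t)) (q (i + 1)) at_bot) \<and>
        limitin X (\<lambda>t. \<phi> (x n, t)) (q 1) at_top \<and>
        limitin X (\<lambda>t. \<phi> (x 1, t)) (q 1) at_bot)"

lemma no_homoclinic_cycle_fst: "\<not> has_homoclinic_cycle X fst"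
  by (auto simp: has_homoclinic_cycle_def fixed_points_def)

definition null_homotopic_in :: "'a topology \<Rightarrow> 'a set \<Rightarrow> bool" where
  "null_homotopic_in X S \<longleftrightarrow>
     (\<exists>c. homotopic_with (\<lambda>h. True) (subtopology X S) X id (\<lambda>x. c))"

definition category_cover :: "'a topology \<Rightarrow> 'a one_form \<Rightarrow> nat \<Rightarrow> nat \<Rightarrow> bool" where
  "category_cover X \<omega> N k \<longleftrightarrow>
     (\<exists>(F :: 'a set) (G :: nat \<Rightarrow> 'a set). openin X F \<and>
        (\<forall>j\<in>{1..k}. openin X (G j) \<and> null_homotopic_in X (G j)) \<and>
        topspace X = F \<union> (\<Union>j\<in>{1..k}. G j) \<and>
        (\<exists>h :: real \<times> 'a \<Rightarrow> 'a.
           continuous_map (prod_topology (top_of_set {0..1}) (subtopology X F)) X h \<and>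
           (\<forall>x\<in>F. h (0, x) = x \<and> path_integral \<omega> (\<lambda>t. h (t, x)) \<le> - real N)))"

(* On a finite CW complex (compact), the condition does not depend on the representative \<omega>
   of \<xi>, and some k satisfies it. *)
definition cat :: "'a topology \<Rightarrow> ('a chain set \<Rightarrow> real) \<Rightarrow> nat" where
  "cat X \<xi> = (LEAST k. \<exists>\<omega>. closed_one_form X \<omega> \<and> represents X \<omega> \<xi> \<and>
                        (\<forall>N>0. category_cover X \<omega> N k))"

end

theory Submission
  imports Defs
begin

text \<open>
  Let \<open>\<phi>\<close> be a gradient-like flow with finitely many fixed points and no homoclinic cycle, and let
  the energy \<open>E(x, t)\<close> be the integral of the form along the trajectory of \<open>x\<close> over \<open>[0, t]\<close>. A
  point whose energy drops below \<open>-N\<close> lies in \<open>F\<close>, which is deformed along the flow until exactly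
  \<open>N\<close> has been lost. Every other trajectory has bounded energy and hence converges to a fixed
  point \<open>p\<close>, so it enters a given small neighbourhood \<open>V\<close> of \<open>p\<close>.

  The times at which a trajectory is in \<open>V\<close> need not form an interval. But if trajectories
  could start in \<open>V\<close>, leave a fixed neighbourhood \<open>U\<close> of \<open>p\<close> and come back at bounded cost for
  arbitrarily small \<open>V\<close>, they would accumulate, by compactness, on a broken trajectory from \<open>p\<close> to
  \<open>p\<close>, i.e. a homoclinic cycle. So for small \<open>V\<close> the trajectory stays in \<open>U\<close> between any two
  visits to \<open>V\<close>, and visiting times may be averaged with continuous weights. Flowing for the
  averaged time deforms an open set into \<open>U\<close>, which is contractible in \<open>X\<close> for a suitable choice of
  \<open>U\<close>. This gives one null-homotopic set per fixed point.
\<close>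

section \<open>Integrals along curves\<close>

text \<open>The form may have non-zero periods, so its local functions need not glue to a Lyapunov
  function on \<open>X\<close>, and strict decrease alone does not keep a trajectory from coming
  back to \<open>p\<close>. Energy is therefore a quantity of trajectory pieces, additive under
  concatenation, and a bound on the loss is what forces limits of pieces to run between fixed
  points. The time spent near a fixed point is unbounded, so continuity of the flow over bounded
  times yields no limit of a whole excursion. The limit is taken of its endpoints, as a relation
  between points, and the broken trajectory is recovered from this relation one connection at a
  time. It may break at several fixed points, which is how cycles of length greater than 1 arise.
  Compactness is used through cluster points of directed families of sets, so no metric or
  countability enters. The neighbourhoods depend on \<open>N\<close>, but the number of
  null-homotopic sets does not, as \<open>cat\<close> demands.\<close>

inductive integral_over :: "'a one_form \<Rightarrow> (real \<Rightarrow> 'a) \<Rightarrow> real \<Rightarrow> real \<Rightarrow> real \<Rightarrow> bool"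
  for \<omega> c where
  refl: "integral_over \<omega> c a a 0"
| step: "integral_over \<omega> c a b I \<Longrightarrow> b < d \<Longrightarrow> (U, f) \<in> \<omega> \<Longrightarrow> c ` {b..d} \<subseteq> U \<Longrightarrow>
           integral_over \<omega> c a d (I + (f (c d) - f (c b)))"

lemma integral_over_le: "integral_over \<omega> c a b I \<Longrightarrow> a \<le> b"
  by (induction rule: integral_over.induct) auto

lemma integral_over_segment:
  assumes "a \<le> b" "(U, f) \<in> \<omega>" "c ` {a..b} \<subseteq> U"
  shows "integral_over \<omega> c a b (f (c b) - f (c a))"
proof (cases "a = b")
  case True then show ?thesis by (simp add: integral_over.refl)
next
  case False
  then show ?thesis using integral_over.step[OF integral_over.refl, of a b U f] assms by auto
qed

lemma integral_over_add:
  assumes "integral_over \<omega> c b d J" "integral_over \<omega> c a b I"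
  shows "integral_over \<omega> c a d (I + J)"
  using assms
proof (induction rule: integral_over.induct)
  case (step b0 b1 J d U f)
  then show ?case
    using integral_over.step[of \<omega> c a b1 "I + J" d U f] by (simp add: add.assoc)
qed auto

lemma integral_over_split:
  assumes "integral_over \<omega> c a d K" "a \<le> b" "b \<le> d"
  shows "\<exists>I J. integral_over \<omega> c a b I \<and> integral_over \<omega> c b d J \<and> K = I + J"
  using assms
proof (induction rule: integral_over.induct)
  case (refl a)
  then show ?case by (force intro: integral_over.refl)
next
  case (step a e I d U f)
  show ?case
  proof (cases "b \<le> e")
    case True
    then obtain I' J where "integral_over \<omega> c a b I'" "integral_over \<omega> c b e J" "I = I' + J"
      using step by auto
    then show ?thesis
      using step integral_over.step[of \<omega> c b e J d U f] by (metis add.assoc)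
  next
    case False
    have "integral_over \<omega> c a b (I + (f (c b) - f (c e)))"
      using False step by (intro integral_over.step[of _ _ _ e _ _ U]) auto
    moreover have "integral_over \<omega> c b d (f (c d) - f (c b))"
      using False step by (intro integral_over_segment[of _ _ U]) auto
    moreover have "I + (f (c d) - f (c e)) = (I + (f (c b) - f (c e))) + (f (c d) - f (c b))"
      by simp
    ultimately show ?thesis by blast
  qed
qed

lemma integral_over_affine:
  assumes "integral_over \<omega> c a b I" "m > 0"
  shows "integral_over \<omega> (\<lambda>s. c (m * s + r)) ((a - r) / m) ((b - r) / m) I"
  using assms(1)
proof (induction rule: integral_over.induct)
  case (step a b I d U f)
  have "m * s + r \<in> {b..d}" if "s \<in> {(b - r) / m..(d - r) / m}" for s
    using that \<open>m > 0\<close> by (auto simp: field_simps)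
  then have "(\<lambda>s. c (m * s + r)) ` {(b - r) / m..(d - r) / m} \<subseteq> U"
    using step by blast
  then show ?case
    using integral_over.step[OF step.IH, of "(d - r) / m" U f] step \<open>m > 0\<close>
    by (auto simp: divide_strict_right_mono)
qed (rule integral_over.refl)

text \<open>Translation between two encodings of a subdivision: the inductive one grows by one chart
  at its right end and suits induction, the indexed one is that of
  \<open>has_path_integral\<close>.\<close>

lemma integral_over_imp_has_path_integral:
  assumes "integral_over \<omega> c 0 1 I"
  shows "has_path_integral \<omega> c I"
proof -
  have "\<exists>N t U f. t (0::nat) = a \<and> t N = b \<and>
          (\<forall>i<N. t i < t (Suc i) \<and> (U i, f i) \<in> \<omega> \<and> c ` {t i..t (Suc i)} \<subseteq> U i) \<and>
          J = (\<Sum>i<N. f i (c (t (Suc i))) - f i (c (t i)))"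
    if "integral_over \<omega> c a b J" for a b J
    using that
  proof (induction rule: integral_over.induct)
    case (refl a)
    show ?case by (rule exI[of _ 0]) auto
  next
    case (step a b I d V g)
    then obtain N t U f where *: "t (0::nat) = a" "t N = b"
      "\<forall>i<N. t i < t (Suc i) \<and> (U i, f i) \<in> \<omega> \<and> c ` {t i..t (Suc i)} \<subseteq> U i"
      "I = (\<Sum>i<N. f i (c (t (Suc i))) - f i (c (t i)))"
      by blast
    define t' U' f' where "t' = t(Suc N := d)" and "U' = U(N := V)" and "f' = f(N := g)"
    have "(\<Sum>i<N. f' i (c (t' (Suc i))) - f' i (c (t' i))) = I"
      unfolding * by (rule sum.cong) (auto simp: t'_def f'_def)
    then have "I + (g (c d) - g (c b)) = (\<Sum>i<Suc N. f' i (c (t' (Suc i))) - f' i (c (t' i)))"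
      using * by (simp add: t'_def f'_def)
    moreover have "\<forall>i<Suc N. t' i < t' (Suc i) \<and> (U' i, f' i) \<in> \<omega> \<and> c ` {t' i..t' (Suc i)} \<subseteq> U' i"
      using * step by (auto simp: t'_def U'_def f'_def less_Suc_eq)
    moreover have "t' 0 = a" "t' (Suc N) = d"
      using * by (auto simp: t'_def)
    ultimately show ?case by blast
  qed
  from this[OF assms] show ?thesis unfolding has_path_integral_def by blast
qed

lemma has_path_integral_imp_integral_over:
  assumes "has_path_integral \<omega> c I"
  shows "integral_over \<omega> c 0 1 I"
proof -
  obtain N t U f where *: "t (0::nat) = 0" "t N = 1"
      "\<forall>i<N. t i < t (Suc i) \<and> (U i, f i) \<in> \<omega> \<and> c ` {t i..t (Suc i)} \<subseteq> U i"
      "I = (\<Sum>i<N. f i (c (t (Suc i))) - f i (c (t i)))"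
    using assms unfolding has_path_integral_def by blast
  have "integral_over \<omega> c (t 0) (t n) (\<Sum>i<n. f i (c (t (Suc i))) - f i (c (t i)))" if "n \<le> N" for n
    using that
  proof (induction n)
    case 0 show ?case by (simp add: integral_over.refl)
  next
    case (Suc n)
    then show ?case
      using integral_over.step[of \<omega> c "t 0" "t n" _ "t (Suc n)" "U n" "f n"] * by simp
  qed
  from this[of N] show ?thesis using * by simp
qed

locale closed_form =
  fixes X :: "'a topology" and \<omega> :: "'a one_form"
  assumes form: "closed_one_form X \<omega>"
begin

lemma form_open: "(U, f) \<in> \<omega> \<Longrightarrow> openin X U"
  and form_continuous: "(U, f) \<in> \<omega> \<Longrightarrow> continuous_map (subtopology X U) euclideanreal f"
  using form unfolding closed_one_form_def by auto

lemma form_cover: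
  assumes "x \<in> topspace X" obtains U f where "(U, f) \<in> \<omega>" "x \<in> U"
  using form assms unfolding closed_one_form_def by blast

text \<open>The difference of \<open>f\<close> and \<open>g\<close> is only locally constant on
  \<open>U \<inter> V\<close>, which may be disconnected. The curve stays in this set over the
  connected interval \<open>{a..b}\<close>, so the difference is constant along it.\<close>

lemma form_increment_eq:
  assumes c: "continuous_map euclideanreal X c"
    and U: "(U, f) \<in> \<omega>" "c ` {a..b} \<subseteq> U" and V: "(V, g) \<in> \<omega>" "c ` {a..b} \<subseteq> V" and "a \<le> b"
  shows "f (c b) - f (c a) = g (c b) - g (c a)"
proof -
  define R where "R s t \<longleftrightarrow> f (c s) - g (c s) = f (c t) - g (c t)" for s t
  have lc: "locally_constant_on X (U \<inter> V) (\<lambda>x. f x - g x)"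
    using form U(1) V(1) unfolding closed_one_form_def by fastforce
  have "R a b"
  proof (rule connected_equivalence_relation[of "{a..b}"])
    fix s assume s: "s \<in> {a..b}"
    then have "c s \<in> U \<inter> V" using U V by auto
    then obtain W where W: "openin (subtopology X (U \<inter> V)) W" "c s \<in> W"
      "\<And>y. y \<in> W \<Longrightarrow> f y - g y = f (c s) - g (c s)"
      using lc unfolding locally_constant_on_def by metis
    have "openin X (U \<inter> V)" using form_open U V by blast
    then have "openin X W" using W(1) openin_open_subtopology by blast
    then have "open {t. c t \<in> W}"
      using openin_continuous_map_preimage[OF c] by auto
    then have "openin (top_of_set {a..b}) ({a..b} \<inter> {t. c t \<in> W})"
      by (rule openin_open_Int)
    then show "\<exists>T. openin (top_of_set {a..b}) T \<and> s \<in> T \<and> (\<forall>t\<in>T. R s t)"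
      using W s unfolding R_def by (metis (no_types, lifting) Int_iff mem_Collect_eq)
  qed (use \<open>a \<le> b\<close> in \<open>auto simp: R_def\<close>)
  then show ?thesis by (simp add: R_def)
qed

lemma integral_over_in_chart:
  assumes "integral_over \<omega> c a b I" "continuous_map euclideanreal X c"
    and "(U, f) \<in> \<omega>" "c ` {a..b} \<subseteq> U"
  shows "I = f (c b) - f (c a)"
  using assms
proof (induction rule: integral_over.induct)
  case (step a b I d V g)
  have "a \<le> b" using step by (auto dest: integral_over_le)
  then have "c ` {a..b} \<subseteq> c ` {a..d}" "c ` {b..d} \<subseteq> c ` {a..d}" using step by auto
  then have "I = f (c b) - f (c a)" "f (c d) - f (c b) = g (c d) - g (c b)"
    using step form_increment_eq[of c U f b d V g] by auto
  then show ?case by simp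
qed auto

lemma chart_near:
  assumes c: "continuous_map euclideanreal X c"
  obtains d U f where "d > 0" "(U, f) \<in> \<omega>"
    "\<And>a b. a \<le> t \<Longrightarrow> t \<le> b \<Longrightarrow> b - a < d \<Longrightarrow> c ` {a..b} \<subseteq> U"
proof -
  have "c t \<in> topspace X" using c by (auto simp: continuous_map_def)
  then obtain U f where U: "(U, f) \<in> \<omega>" "c t \<in> U" by (rule form_cover)
  have "open {s. c s \<in> U}"
    using openin_continuous_map_preimage[OF c form_open[OF U(1)]] by auto
  then obtain d where d: "d > 0" "ball t d \<subseteq> {s. c s \<in> U}"
    using U(2) open_contains_ball by blast
  have "c ` {a..b} \<subseteq> U" if "a \<le> t" "t \<le> b" "b - a < d" for a b
  proof -
    have "{a..b} \<subseteq> ball t d" using that by (auto simp: dist_real_def)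
    then show ?thesis using d by blast
  qed
  then show ?thesis using that d U by blast
qed

text \<open>Bisection replaces both the Lebesgue number and a common refinement:
  \<open>integral_over_split\<close> cuts any given subdivision at an intermediate time, and over a
  short interval a single chart contains the curve and fixes the value.\<close>

lemma integral_over_ex1:
  assumes c: "continuous_map euclideanreal X c" and "a \<le> b"
  shows "\<exists>!I. integral_over \<omega> c a b I"
  using \<open>a \<le> b\<close>
proof (induction rule: Bolzano)
  case (trans a b d)
  then obtain I J where I: "integral_over \<omega> c a b I" and J: "integral_over \<omega> c b d J" by blast
  show ?case
  proof (rule ex1I)
    show "integral_over \<omega> c a d (I + J)" by (rule integral_over_add[OF J I])
  next
    fix K assume "integral_over \<omega> c a d K"
    then obtain I' J' where "integral_over \<omega> c a b I'" "integral_over \<omega> c b d J'" "K = I' + J'"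
      using integral_over_split trans(3,4) by blast
    then show "K = I + J" using trans I J by blast
  qed
next
  case (local t)
  obtain d U f where "d > 0" and U: "(U, f) \<in> \<omega>"
    "\<And>a b. a \<le> t \<Longrightarrow> t \<le> b \<Longrightarrow> b - a < d \<Longrightarrow> c ` {a..b} \<subseteq> U"
    using chart_near[OF c, of t] by metis
  have "\<exists>!I. integral_over \<omega> c a b I" if "a \<le> t" "t \<le> b" "b - a < d" for a b
  proof (rule ex1I)
    show "integral_over \<omega> c a b (f (c b) - f (c a))"
      using integral_over_segment[OF _ U(1) U(2)] that by auto
    show "\<And>I. integral_over \<omega> c a b I \<Longrightarrow> I = f (c b) - f (c a)"
      using integral_over_in_chart[OF _ c U(1) U(2)] that by blast
  qed
  then show ?case using \<open>d > 0\<close> by blast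
qed

lemma path_integral_eqI:
  assumes "integral_over \<omega> c 0 1 I" "continuous_map euclideanreal X c"
  shows "path_integral \<omega> c = I"
  unfolding path_integral_def
  using assms integral_over_ex1[of c 0 1]
  by (intro the_equality)
     (auto intro: integral_over_imp_has_path_integral dest: has_path_integral_imp_integral_over)

text \<open>Additivity in time needs integrals over arbitrary parameter intervals. The description
  is meaningful for \<open>a \<le> b\<close> and for curves continuous on the whole line, as
  trajectories are.\<close>

definition integ :: "(real \<Rightarrow> 'a) \<Rightarrow> real \<Rightarrow> real \<Rightarrow> real" where
  "integ c a b = (THE I. integral_over \<omega> c a b I)"

context
  fixes c assumes c: "continuous_map euclideanreal X c"
begin

lemma integral_over_integ: "a \<le> b \<Longrightarrow> integral_over \<omega> c a b (integ c a b)"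
  unfolding integ_def by (rule theI'[OF integral_over_ex1[OF c]])

lemma integ_eqI: "integral_over \<omega> c a b I \<Longrightarrow> integ c a b = I"
  using integral_over_ex1[OF c, of a b] integral_over_integ[of a b] integral_over_le[of \<omega> c a b I] by auto

lemma integ_refl [simp]: "integ c a a = 0"
  by (rule integ_eqI) (rule integral_over.refl)

lemma integ_add: "a \<le> b \<Longrightarrow> b \<le> d \<Longrightarrow> integ c a d = integ c a b + integ c b d"
  by (rule integ_eqI) (auto intro: integral_over_add integral_over_integ)

lemma integ_chart: "a \<le> b \<Longrightarrow> (U, f) \<in> \<omega> \<Longrightarrow> c ` {a..b} \<subseteq> U \<Longrightarrow> integ c a b = f (c b) - f (c a)"
  by (rule integ_eqI) (rule integral_over_segment)

lemma continuous_integ: "a \<le> b \<Longrightarrow> continuous_on {a..b} (integ c a)"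
proof (induction rule: Bolzano)
  case (trans a b d)
  have "continuous_on {b..d} (\<lambda>s. integ c a b + integ c b s)"
    using trans(2) by (rule continuous_on_add[OF continuous_on_const])
  then have "continuous_on {b..d} (integ c a)"
    by (rule continuous_on_eq) (rule integ_add[symmetric], use trans(3) in auto)
  then have "continuous_on ({a..b} \<union> {b..d}) (integ c a)"
    using trans by (intro continuous_on_closed_Un) auto
  then show ?case using trans by (simp add: ivl_disj_un)
next
  case (local t)
  obtain d U f where d: "d > 0" and U: "(U, f) \<in> \<omega>"
    "\<And>a b. a \<le> t \<Longrightarrow> t \<le> b \<Longrightarrow> b - a < d \<Longrightarrow> c ` {a..b} \<subseteq> U"
    using chart_near[OF c, of t] by metis
  have "continuous_on {a..b} (integ c a)" if "a \<le> t" "t \<le> b" "b - a < d" for a b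
  proof -
    have "c ` {a..b} \<subseteq> U" using that U by blast
    then have "continuous_map (top_of_set {a..b}) (subtopology X U) c"
      using c by (auto simp: continuous_map_in_subtopology intro: continuous_map_from_subtopology)
    from continuous_map_compose[OF this form_continuous[OF U(1)]]
    have "continuous_on {a..b} (\<lambda>s. f (c s) - f (c a))"
      by (intro continuous_intros) (simp add: o_def)
    then show ?thesis
    proof (rule continuous_on_eq)
      fix s assume "s \<in> {a..b}"
      moreover from this have "c ` {a..s} \<subseteq> c ` {a..b}" by auto
      ultimately show "f (c s) - f (c a) = integ c a s"
        using \<open>c ` {a..b} \<subseteq> U\<close> U(1) integ_chart[of a s U f] by auto
    qed
  qed
  then show ?case using d by blast
qed

lemma path_integral_integ: "path_integral \<omega> c = integ c 0 1"
  using path_integral_eqI[OF _ c] integral_over_integ by simp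

end

text \<open>One substitution rule for two uses: \<open>m = 1\<close> gives additivity of the energy
  along the flow, and \<open>r = 0\<close> rescales a trajectory to the unit interval.\<close>

lemma integ_affine:
  assumes c: "continuous_map euclideanreal X c" and "a \<le> b" "m > 0"
  shows "integ (\<lambda>s. c (m * s + r)) a b = integ c (m * a + r) (m * b + r)"
proof (rule integ_eqI)
  show "continuous_map euclideanreal X (\<lambda>s. c (m * s + r))"
    using continuous_map_compose[OF _ c, of euclideanreal "\<lambda>s. m * s + r"]
    by (simp add: o_def continuous_on_add continuous_on_mult)
  show "integral_over \<omega> (\<lambda>s. c (m * s + r)) a b (integ c (m * a + r) (m * b + r))"
    using integral_over_affine[OF integral_over_integ[OF c, of "m * a + r" "m * b + r"] \<open>m > 0\<close>, of r] assms
    by simp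
qed

end

section \<open>Energy along a gradient-like flow\<close>

locale gradient_flow = closed_form +
  fixes \<phi> :: "'a \<times> real \<Rightarrow> 'a"
  assumes gradient_like: "gradient_like_flow X \<omega> \<phi>"
begin

lemma flow_continuous: "continuous_map (prod_topology X euclideanreal) X \<phi>"
  and flow_0 [simp]: "x \<in> topspace X \<Longrightarrow> \<phi> (x, 0) = x"
  and flow_add: "x \<in> topspace X \<Longrightarrow> \<phi> (\<phi> (x, s), t) = \<phi> (x, s + t)"
  using gradient_like unfolding gradient_like_flow_def continuous_flow_def by blast+

lemma flow_in [simp]: "x \<in> topspace X \<Longrightarrow> \<phi> (x, t) \<in> topspace X"
  using flow_continuous by (auto simp: continuous_map_def Pi_iff)

lemma flow_orbit_continuous [simp]:
  assumes "x \<in> topspace X" shows "continuous_map euclideanreal X (\<lambda>t. \<phi> (x, t))"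
  using continuous_map_compose[OF _ flow_continuous, of euclideanreal "Pair x"] assms
  by (simp add: o_def continuous_map_pairwise)

lemma flow_time_continuous: "continuous_map X X (\<lambda>x. \<phi> (x, t))"
  using continuous_map_compose[OF _ flow_continuous, of X "\<lambda>x. (x, t)"]
  by (simp add: o_def continuous_map_pairwise)

lemma gradient_like_decreasing:
  assumes "(U, f) \<in> \<omega>" "x \<in> topspace X - fixed_points X \<phi>" "s < t" "\<And>r. r \<in> {s..t} \<Longrightarrow> \<phi> (x, r) \<in> U"
  shows "f (\<phi> (x, t)) < f (\<phi> (x, s))"
proof -
  have "\<forall>(U, f)\<in>\<omega>. \<forall>x\<in>topspace X - fixed_points X \<phi>. \<forall>s t.
      s < t \<and> (\<forall>r\<in>{s..t}. \<phi> (x, r) \<in> U) \<longrightarrow> f (\<phi> (x, t)) < f (\<phi> (x, s))"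
    using gradient_like unfolding gradient_like_flow_def by (rule conjunct2)
  from bspec[OF this assms(1)] show ?thesis using assms(2-4) by simp
qed

lemma flow_fixed: "x \<in> fixed_points X \<phi> \<Longrightarrow> \<phi> (x, t) = x"
  and fixed_in: "x \<in> fixed_points X \<phi> \<Longrightarrow> x \<in> topspace X"
  by (auto simp: fixed_points_def)

lemma flow_nonfixed:
  assumes "x \<in> topspace X - fixed_points X \<phi>"
  shows "\<phi> (x, t) \<in> topspace X - fixed_points X \<phi>"
proof -
  have "\<phi> (x, t) \<notin> fixed_points X \<phi>"
  proof
    assume "\<phi> (x, t) \<in> fixed_points X \<phi>"
    then have stays: "\<phi> (\<phi> (x, t), s) = \<phi> (x, t)" for s by (rule flow_fixed)
    have x: "x \<in> topspace X" using assms by simp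
    have "\<phi> (x, r) = \<phi> (x, t)" for r
      using stays[of "r - t"] by (simp add: flow_add[OF x])
    from this[of 0] have "\<phi> (x, t) = x" using x by simp
    then show False using assms \<open>\<phi> (x, t) \<in> fixed_points X \<phi>\<close> by simp
  qed
  then show ?thesis using assms by simp
qed

definition energy :: "'a \<Rightarrow> real \<Rightarrow> real" where
  "energy x t = integ (\<lambda>s. \<phi> (x, s)) 0 t"

lemma energy_0 [simp]: "x \<in> topspace X \<Longrightarrow> energy x 0 = 0"
  by (simp add: energy_def)

lemma energy_add:
  assumes x: "x \<in> topspace X" and "0 \<le> s" "0 \<le> t"
  shows "energy x (s + t) = energy x s + energy (\<phi> (x, s)) t"
proof -
  have "energy (\<phi> (x, s)) t = integ (\<lambda>r. \<phi> (x, 1 * r + s)) 0 t"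
    unfolding energy_def by (simp add: flow_add x add.commute)
  also have "\<dots> = integ (\<lambda>r. \<phi> (x, r)) s (s + t)"
    using integ_affine[OF flow_orbit_continuous[OF x], of 0 t 1 s] assms by (simp add: add.commute)
  finally show ?thesis
    using integ_add[OF flow_orbit_continuous[OF x], of 0 s "s + t"] assms
    by (simp add: energy_def)
qed

lemma energy_fixed:
  assumes "x \<in> fixed_points X \<phi>" "0 \<le> t" shows "energy x t = 0"
proof -
  have x: "x \<in> topspace X" using assms fixed_in by blast
  have const: "I = 0" if "integral_over \<omega> (\<lambda>s. \<phi> (x, s)) a b I" for a b I
    using that by (induction rule: integral_over.induct) (auto simp: flow_fixed[OF assms(1)])
  show ?thesis
    unfolding energy_def
    by (rule const[OF integral_over_integ]) (use x assms in auto)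
qed

text \<open>The gradient-like condition compares two times only while the trajectory stays in one
  chart; bisection carries the strict sign to long intervals.\<close>

lemma energy_neg:
  assumes x: "x \<in> topspace X - fixed_points X \<phi>" and "0 < t"
  shows "energy x t < 0"
proof -
  have c: "continuous_map euclideanreal X (\<lambda>s. \<phi> (x, s))" using x by simp
  \<comment> \<open>Intervals in the bisection may degenerate to a point, where the integral is 0;
    hence the premise \<open>a < b\<close>.\<close>
  have "a < b \<longrightarrow> integ (\<lambda>s. \<phi> (x, s)) a b < 0" if "a \<le> b" for a b
    using that
  proof (induction rule: Bolzano)
    case (trans a b d)
    have "integ (\<lambda>s. \<phi> (x, s)) a d = integ (\<lambda>s. \<phi> (x, s)) a b + integ (\<lambda>s. \<phi> (x, s)) b d"
      using trans by (intro integ_add[OF c])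
    moreover have "integ (\<lambda>s. \<phi> (x, s)) a b \<le> 0" "integ (\<lambda>s. \<phi> (x, s)) b d \<le> 0"
      using trans integ_refl[OF c, of a] integ_refl[OF c, of b] by (auto simp: le_less)
    moreover have "a < b \<or> b < d" if "a < d" using that trans(3,4) by linarith
    ultimately show ?case using trans(1,2) by fastforce
  next
    case (local t)
    obtain d U f where d: "d > 0" and U: "(U, f) \<in> \<omega>"
      "\<And>a b. a \<le> t \<Longrightarrow> t \<le> b \<Longrightarrow> b - a < d \<Longrightarrow> (\<lambda>s. \<phi> (x, s)) ` {a..b} \<subseteq> U"
      using chart_near[OF c, of t] by metis
    have "integ (\<lambda>s. \<phi> (x, s)) a b < 0" if "a \<le> t" "t \<le> b" "b - a < d" "a < b" for a b
    proof -
      have "f (\<phi> (x, b)) < f (\<phi> (x, a))"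
        using gradient_like_decreasing[OF U(1) x \<open>a < b\<close>] U(2)[OF that(1-3)] by blast
      then show ?thesis
        using integ_chart[OF c _ U(1) U(2), of a b] that by simp
    qed
    then show ?case using d by blast
  qed
  from this[of 0 t] show ?thesis using \<open>0 < t\<close> by (simp add: energy_def)
qed

lemma energy_nonpos: "x \<in> topspace X \<Longrightarrow> 0 \<le> t \<Longrightarrow> energy x t \<le> 0"
  using energy_fixed[of x t] energy_neg[of x t] energy_0[of x] by (cases "t = 0") (auto simp: le_less)

lemma energy_antimono:
  "x \<in> topspace X \<Longrightarrow> 0 \<le> s \<Longrightarrow> s \<le> t \<Longrightarrow> energy x t \<le> energy x s"
  using energy_add[of x s "t - s"] energy_nonpos[of "\<phi> (x, s)" "t - s"] by simp

lemma energy_strict_antimono: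
  "x \<in> topspace X - fixed_points X \<phi> \<Longrightarrow> 0 \<le> s \<Longrightarrow> s < t \<Longrightarrow> energy x t < energy x s"
  using energy_add[of x s "t - s"] energy_neg[OF flow_nonfixed, of x "t - s" s] by simp

lemma energy_tail_ge:
  "x \<in> topspace X \<Longrightarrow> 0 \<le> s \<Longrightarrow> s \<le> t \<Longrightarrow> energy x t \<le> energy (\<phi> (x, s)) (t - s)"
  using energy_add[of x s "t - s"] energy_nonpos[of x s] by simp

lemma energy_continuous_time: "x \<in> topspace X \<Longrightarrow> 0 \<le> t \<Longrightarrow> continuous_on {0..t} (energy x)"
  unfolding energy_def by (rule continuous_integ) auto

text \<open>Bisection in the time variable at a given point \<open>x0\<close>: over a short interval
  a neighbourhood of \<open>x0\<close> flows inside one chart, where the integral is a difference of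
  two values of \<open>f\<close>. Joining two intervals intersects their neighbourhoods.\<close>

lemma energy_continuous_space:
  assumes "0 \<le> t" shows "continuous_map X euclideanreal (\<lambda>x. energy x t)"
proof -
  define J where "J a b x = integ (\<lambda>s. \<phi> (x, s)) a b" for a b x
  have local: "\<exists>W. openin X W \<and> x0 \<in> W \<and> continuous_map (subtopology X W) euclideanreal (J 0 t)"
    if x0: "x0 \<in> topspace X" for x0
    using \<open>0 \<le> t\<close>
  proof (induction rule: Bolzano)
    case (trans a b d)
    then obtain V W where V: "openin X V" "x0 \<in> V" "continuous_map (subtopology X V) euclideanreal (J a b)"
      and W: "openin X W" "x0 \<in> W" "continuous_map (subtopology X W) euclideanreal (J b d)"
      by blast
    have "continuous_map (subtopology X (V \<inter> W)) euclideanreal (\<lambda>x. J a b x + J b d x)"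
      using continuous_map_from_subtopology_mono[OF V(3), of "V \<inter> W"]
        continuous_map_from_subtopology_mono[OF W(3), of "V \<inter> W"]
      by (intro continuous_map_add) auto
    then have "continuous_map (subtopology X (V \<inter> W)) euclideanreal (J a d)"
    proof (rule continuous_map_eq)
      fix x assume "x \<in> topspace (subtopology X (V \<inter> W))"
      then show "J a b x + J b d x = J a d x"
        using integ_add[of "\<lambda>s. \<phi> (x, s)" a b d] trans(3,4) by (simp add: J_def)
    qed
    then show ?case using V W by blast
  next
    case (local t)
    have "\<phi> (x0, t) \<in> topspace X" using x0 by simp
    then obtain U f where U: "(U, f) \<in> \<omega>" "\<phi> (x0, t) \<in> U" by (rule form_cover)
    define O' where "O' = {z \<in> topspace (prod_topology X euclideanreal). \<phi> z \<in> U}"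
    have "openin (prod_topology X euclideanreal) O'"
      unfolding O'_def by (rule openin_continuous_map_preimage[OF flow_continuous form_open[OF U(1)]])
    moreover have "(x0, t) \<in> O'"
      using x0 U by (simp add: O'_def)
    ultimately obtain W T where W: "openin X W" "x0 \<in> W" and T: "open T" "t \<in> T"
      and WT: "W \<times> T \<subseteq> O'"
      unfolding openin_prod_topology_alt open_openin[symmetric] by blast
    obtain d where d: "d > 0" "ball t d \<subseteq> T"
      using T open_contains_ball by blast
    have cont: "continuous_map (subtopology X W) euclideanreal (\<lambda>x. f (\<phi> (x, s)))" if "s \<in> T" for s
    proof -
      have "continuous_map (subtopology X W) (subtopology X U) (\<lambda>x. \<phi> (x, s))"
        using WT that flow_time_continuous unfolding O'_def
        by (auto simp: continuous_map_in_subtopology continuous_map_from_subtopology)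
      from continuous_map_compose[OF this form_continuous[OF U(1)]]
      show ?thesis by (simp add: o_def)
    qed
    have "continuous_map (subtopology X W) euclideanreal (J a b)"
      if ab: "a \<le> t" "t \<le> b" "b - a < d" for a b
    proof -
      have "{a..b} \<subseteq> ball t d" using ab by (auto simp: dist_real_def)
      then have T: "{a..b} \<subseteq> T" using d by blast
      have "continuous_map (subtopology X W) euclideanreal (\<lambda>x. f (\<phi> (x, b)) - f (\<phi> (x, a)))"
        using T ab by (intro continuous_map_diff cont) auto
      then show ?thesis
      proof (rule continuous_map_eq)
        fix x assume "x \<in> topspace (subtopology X W)"
        then have x: "x \<in> topspace X" "x \<in> W" by auto
        then have "(\<lambda>s. \<phi> (x, s)) ` {a..b} \<subseteq> U" using WT T by (auto simp: O'_def)
        then show "f (\<phi> (x, b)) - f (\<phi> (x, a)) = J a b x"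
          unfolding J_def using integ_chart[of "\<lambda>s. \<phi> (x, s)" a b U f] x U ab by simp
      qed
    qed
    then show ?case using W d by blast
  qed
  then obtain W where W: "\<And>x. x \<in> topspace X \<Longrightarrow> openin X (W x) \<and> x \<in> W x \<and>
      continuous_map (subtopology X (W x)) euclideanreal (J 0 t)"
    by metis
  have "continuous_map X euclideanreal (J 0 t)"
    by (rule pasting_lemma[where I = "topspace X" and T = W and f = "\<lambda>_. J 0 t"]) (use W in auto)
  then show ?thesis by (simp add: J_def[abs_def] energy_def)
qed

lemma path_integral_orbit:
  assumes x: "x \<in> topspace X" and "0 < t"
  shows "path_integral \<omega> (\<lambda>s. \<phi> (x, s * t)) = energy x t"
proof -
  have "continuous_map euclideanreal X (\<lambda>s. \<phi> (x, t * s + 0))"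
    using continuous_map_compose[OF _ flow_orbit_continuous[OF x], of euclideanreal "\<lambda>s. t * s + 0"]
    by (simp add: o_def)
  from path_integral_integ[OF this] show ?thesis
    using integ_affine[OF flow_orbit_continuous[OF x], of 0 1 t 0] \<open>0 < t\<close>
    by (simp add: energy_def mult.commute)
qed

end

section \<open>Broken trajectories\<close>

text \<open>This takes the role of a convergent subsequence. If every point of \<open>D\<close> had
  a neighbourhood missing some \<open>S i\<close>, finitely many of them would cover
  \<open>D\<close>, and a set \<open>S k\<close> below the corresponding finitely many
  \<open>S i\<close> could not meet \<open>D\<close>.\<close>

lemma compact_directed_cluster_point:
  assumes D: "compactin X D" and "I \<noteq> {}"
    and directed: "\<And>i j. i \<in> I \<Longrightarrow> j \<in> I \<Longrightarrow> \<exists>k\<in>I. S k \<subseteq> S i \<inter> S j"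
    and meets: "\<And>i. i \<in> I \<Longrightarrow> S i \<inter> D \<noteq> {}"
  obtains a where "a \<in> D" "\<And>i V. i \<in> I \<Longrightarrow> openin X V \<Longrightarrow> a \<in> V \<Longrightarrow> V \<inter> S i \<noteq> {}"
proof -
  have "\<exists>a\<in>D. \<forall>i\<in>I. \<forall>V. openin X V \<and> a \<in> V \<longrightarrow> V \<inter> S i \<noteq> {}"
  proof (rule ccontr)
    assume "\<not> ?thesis"
    then have "\<forall>a\<in>D. \<exists>i V. i \<in> I \<and> openin X V \<and> a \<in> V \<and> V \<inter> S i = {}" by blast
    then obtain i V where iV: "\<And>a. a \<in> D \<Longrightarrow> i a \<in> I \<and> openin X (V a) \<and> a \<in> V a \<and> V a \<inter> S (i a) = {}"
      by metis
    have "\<exists>\<F>. finite \<F> \<and> \<F> \<subseteq> V ` D \<and> D \<subseteq> \<Union>\<F>"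
      by (rule compactinD[OF D]) (use iV in auto)
    then obtain \<F> where \<F>: "finite \<F>" "\<F> \<subseteq> V ` D" "D \<subseteq> \<Union>\<F>" by blast
    then obtain A where A: "A \<subseteq> D" "finite A" "\<F> = V ` A"
      using finite_subset_image[OF \<F>(1,2)] by blast
    have cover: "D \<subseteq> \<Union>(V ` A)" using \<F>(3) A(3) by simp
    have "\<exists>k\<in>I. \<forall>a\<in>A. S k \<subseteq> S (i a)"
      using A(2,1)
    proof (induction A rule: finite_induct)
      case empty
      then show ?case using \<open>I \<noteq> {}\<close> by blast
    next
      case (insert a A)
      then obtain k where k: "k \<in> I" "\<forall>a\<in>A. S k \<subseteq> S (i a)" by blast
      have "i a \<in> I" using insert iV by blast
      from directed[OF k(1) this] show ?case using k by blast
    qed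
    then obtain k where k: "k \<in> I" "\<forall>a\<in>A. S k \<subseteq> S (i a)" by blast
    then obtain y where y: "y \<in> S k" "y \<in> D" using meets by blast
    then obtain a where "a \<in> A" "y \<in> V a" using cover by blast
    then show False using k y iV A by blast
  qed
  then show ?thesis using that by blast
qed

locale compact_gradient_flow = gradient_flow +
  assumes compact: "compact_space X" and Hausdorff: "Hausdorff_space X"
    and finite_fixed: "finite (fixed_points X \<phi>)"
begin

lemma compactin_closed: "closedin X S \<Longrightarrow> compactin X S"
  using compact closedin_compact_space by blast

lemma separate_fixed:
  assumes "q \<in> topspace X" "finite A" "A \<subseteq> topspace X" "q \<notin> A"
  obtains U V where "openin X U" "openin X V" "q \<in> U" "A \<subseteq> V" "U \<inter> V = {}"
proof -
  have "compactin X {q}" "compactin X A" "disjnt {q} A"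
    using assms by (auto simp: finite_imp_compactin)
  then obtain U V where "openin X U" "openin X V" "{q} \<subseteq> U" "A \<subseteq> V" "disjnt U V"
    by (rule Hausdorff_space_compact_separation[OF Hausdorff])
  then show ?thesis by (intro that[of U V]) (auto simp: disjnt_def)
qed

text \<open>In a compact Hausdorff space the cluster points of a curve form a connected set, and a
  finite connected set of this kind is a single point. In direct terms: the curve is eventually near
  the fixed points, keeps returning to one of them, and its connected tail cannot jump between
  disjoint open sets.\<close>

lemma limit_if_cluster_points_fixed:
  assumes c: "continuous_map euclideanreal X c"
    and cluster: "\<And>y. y \<in> topspace X \<Longrightarrow>
       (\<And>W T. openin X W \<Longrightarrow> y \<in> W \<Longrightarrow> \<exists>t\<ge>T. c t \<in> W) \<Longrightarrow> y \<in> fixed_points X \<phi>"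
  obtains q where "q \<in> fixed_points X \<phi>" "limitin X c q at_top"
proof -
  have c_in: "c t \<in> topspace X" for t using c by (auto simp: continuous_map_def)
  have near: "\<exists>T. \<forall>t\<ge>T. c t \<in> U" if U: "openin X U" "fixed_points X \<phi> \<subseteq> U" for U
  proof (rule ccontr)
    assume "\<not> ?thesis"
    then have *: "\<exists>t\<ge>T. c t \<notin> U" for T by blast
    have "compactin X (topspace X - U)" using U(1) by (intro compactin_closed) auto
    then obtain a where a: "a \<in> topspace X - U"
      "\<And>T V. T \<in> (UNIV :: real set) \<Longrightarrow> openin X V \<Longrightarrow> a \<in> V \<Longrightarrow> V \<inter> c ` {T..} \<noteq> {}"
    proof (rule compact_directed_cluster_point[where I = "UNIV :: real set" and S = "\<lambda>T. c ` {T..}"])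
      show "\<exists>k\<in>UNIV. c ` {k..} \<subseteq> c ` {i..} \<inter> c ` {j..}" for i j :: real
        by (rule bexI[of _ "max i j"]) auto
      show "c ` {i..} \<inter> (topspace X - U) \<noteq> {}" for i
        using *[of i] c_in by auto
    qed auto
    have "a \<in> fixed_points X \<phi>"
    proof (rule cluster)
      show "\<exists>t\<ge>T. c t \<in> W" if "openin X W" "a \<in> W" for W T
        using a(2)[OF _ that, of T] by auto
    qed (use a(1) in blast)
    then show False using a(1) U(2) by blast
  qed
  have "\<exists>q\<in>fixed_points X \<phi>. \<forall>W T. openin X W \<and> q \<in> W \<longrightarrow> (\<exists>t\<ge>T. c t \<in> W)"
  proof (rule ccontr)
    assume "\<not> ?thesis"
    then have "\<forall>q\<in>fixed_points X \<phi>. \<exists>W. openin X W \<and> q \<in> W \<and> (\<exists>T. \<forall>t\<ge>T. c t \<notin> W)" by simp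
    then obtain W T where W: "\<And>q. q \<in> fixed_points X \<phi> \<Longrightarrow> openin X (W q) \<and> q \<in> W q \<and> (\<forall>t\<ge>T q. c t \<notin> W q)"
      by metis
    have "\<exists>T0. \<forall>t\<ge>T0. c t \<in> \<Union>(W ` fixed_points X \<phi>)"
      by (rule near) (use W in blast)+
    then obtain T0 where T0: "\<And>t. t \<ge> T0 \<Longrightarrow> c t \<in> \<Union>(W ` fixed_points X \<phi>)" by blast
    \<comment> \<open>From this time on the curve avoids every \<open>W q\<close>, although
      \<open>T0\<close> places it in their union.\<close>
    define t where "t = Max (insert T0 (T ` fixed_points X \<phi>))"
    have "t \<ge> T0" "\<And>q. q \<in> fixed_points X \<phi> \<Longrightarrow> t \<ge> T q"
      using finite_fixed by (auto simp: t_def)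
    then show False using T0[of t] W by blast
  qed
  then obtain q where q: "q \<in> fixed_points X \<phi>"
    and often: "\<And>W T. openin X W \<Longrightarrow> q \<in> W \<Longrightarrow> \<exists>t\<ge>T. c t \<in> W" by blast
  have "eventually (\<lambda>t. c t \<in> W) at_top" if W: "openin X W" "q \<in> W" for W
  proof -
    obtain U V where UV: "openin X U" "openin X V" "q \<in> U" "fixed_points X \<phi> - {q} \<subseteq> V" "U \<inter> V = {}"
      using separate_fixed[of q "fixed_points X \<phi> - {q}"] q finite_fixed fixed_in by blast
    have "\<exists>T. \<forall>t\<ge>T. c t \<in> (U \<inter> W) \<union> V"
      by (rule near) (use UV W in auto)
    then obtain T where T: "\<And>t. t \<ge> T \<Longrightarrow> c t \<in> (U \<inter> W) \<union> V" by blast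
    obtain t0 where t0: "t0 \<ge> T" "c t0 \<in> U \<inter> W"
      using often[of "U \<inter> W"] UV W by blast
    have "connectedin X (c ` {T..})"
      by (rule connectedin_continuous_map_image[OF c]) (simp add: connected_Ici)
    moreover have "openin X (U \<inter> W)" using UV W by blast
    moreover have "c ` {T..} \<subseteq> (U \<inter> W) \<union> V" using T by auto
    moreover have "(U \<inter> W) \<inter> V \<inter> c ` {T..} = {}" using UV by blast
    moreover have "(U \<inter> W) \<inter> c ` {T..} \<noteq> {}" using t0 by auto
    ultimately have "V \<inter> c ` {T..} = {}"
      unfolding connectedin using UV(2) by blast
    then have "c t \<in> W" if "t \<ge> T" for t using T[OF that] that by auto
    then show ?thesis unfolding eventually_at_top_linorder by blast
  qed
  then have "limitin X c q at_top" using q fixed_in by (auto simp: limitin_def)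
  then show ?thesis using that q by blast
qed

section \<open>Limits of single trajectories of bounded energy loss\<close>

lemma open_energy_less: "0 \<le> t \<Longrightarrow> openin X {x \<in> topspace X. energy x t < r}"
  using openin_continuous_map_preimage[OF energy_continuous_space, of t "{..<r}"] by simp

text \<open>A point at which energy is lost cannot be visited infinitely often by a trajectory of
  bounded energy.\<close>

lemma forward_limit:
  assumes a: "a \<in> topspace X" and bounded: "\<And>t. 0 \<le> t \<Longrightarrow> - N \<le> energy a t"
  obtains q where "q \<in> fixed_points X \<phi>" "limitin X (\<lambda>t. \<phi> (a, t)) q at_top"
proof (rule limit_if_cluster_points_fixed[of "\<lambda>t. \<phi> (a, t)"])
  fix y assume y: "y \<in> topspace X"
    and often: "\<And>W T. openin X W \<Longrightarrow> y \<in> W \<Longrightarrow> \<exists>t\<ge>T. \<phi> (a, t) \<in> W"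
  show "y \<in> fixed_points X \<phi>"
  proof (rule ccontr)
    assume "y \<notin> fixed_points X \<phi>"
    then have e: "energy y 1 < 0" using y by (intro energy_neg) auto
    define W where "W = {x \<in> topspace X. energy x 1 < energy y 1 / 2}"
    have W: "openin X W" "y \<in> W"
      using open_energy_less[of 1 "energy y 1 / 2"] y e by (simp_all add: W_def)
    define m where "m = Inf (energy a ` {0..})"
    have bdd: "bdd_below (energy a ` {0..})" using bounded by (auto intro!: bdd_belowI)
    \<comment> \<open>\<open>energy y 1\<close> is negative. Once the energy is this close to its
      infimum \<open>m\<close>, a further visit to \<open>W\<close>, which costs more than half of
      \<open>- energy y 1\<close> in unit time, would push it below \<open>m\<close>.\<close>
    have "m < m - energy y 1 / 2" using e by simp
    then obtain T where T: "T \<ge> 0" "energy a T < m - energy y 1 / 2"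
      unfolding m_def using bdd by (subst (asm) cInf_less_iff) auto
    obtain t where t: "t \<ge> T" "\<phi> (a, t) \<in> W"
      using often[OF W, of "T"] by blast
    have "energy a (t + 1) = energy a t + energy (\<phi> (a, t)) 1"
      using energy_add[OF a] t T by simp
    also have "\<dots> < energy a T + energy y 1 / 2"
      using energy_antimono[OF a T(1) t(1)] t(2) by (simp add: W_def)
    also have "\<dots> < m" using T by simp
    finally have "energy a (t + 1) < m" .
    moreover have "m \<le> energy a (t + 1)"
      unfolding m_def using t T by (intro cInf_lower[OF _ bdd]) auto
    ultimately show False by simp
  qed
qed (use a that in auto)

text \<open>Energy is integrated forward in time, so the loss over the last \<open>t\<close> units
  before reaching \<open>a\<close> is \<open>energy (\<phi> (a, - t)) t\<close>. Lengthening the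
  past adds the loss of the earlier piece.\<close>

lemma energy_backward_add:
  assumes "a \<in> topspace X" "0 \<le> s" "0 \<le> t"
  shows "energy (\<phi> (a, - (s + t))) (s + t) = energy (\<phi> (a, - (s + t))) t + energy (\<phi> (a, - s)) s"
  using energy_add[of "\<phi> (a, - (s + t))" t s] assms by (simp add: flow_add add.commute)

text \<open>The argument of \<open>forward_limit\<close> applies to the reversed curve, with the
  loss over a past of length \<open>t\<close> as the monotone bounded quantity.\<close>

lemma backward_limit:
  assumes a: "a \<in> topspace X" and bounded: "\<And>t. 0 \<le> t \<Longrightarrow> - N \<le> energy (\<phi> (a, - t)) t"
  obtains q where "q \<in> fixed_points X \<phi>" "limitin X (\<lambda>t. \<phi> (a, t)) q at_bot"
proof (rule limit_if_cluster_points_fixed[of "\<lambda>t. \<phi> (a, - t)"])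
  show "continuous_map euclideanreal X (\<lambda>t. \<phi> (a, - t))"
    using continuous_map_compose[OF _ flow_orbit_continuous[OF a], of euclideanreal uminus]
    by (simp add: o_def continuous_on_minus)
next
  fix y assume y: "y \<in> topspace X"
    and often: "\<And>W T. openin X W \<Longrightarrow> y \<in> W \<Longrightarrow> \<exists>t\<ge>T. \<phi> (a, - t) \<in> W"
  show "y \<in> fixed_points X \<phi>"
  proof (rule ccontr)
    assume "y \<notin> fixed_points X \<phi>"
    then have e: "energy y 1 < 0" using y by (intro energy_neg) auto
    define W where "W = {x \<in> topspace X. energy x 1 < energy y 1 / 2}"
    have W: "openin X W" "y \<in> W"
      using open_energy_less[of 1 "energy y 1 / 2"] y e by (simp_all add: W_def)
    define B where "B t = energy (\<phi> (a, - t)) t" for t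
    define m where "m = Inf (B ` {0..})"
    have bdd: "bdd_below (B ` {0..})" using bounded by (auto simp: B_def intro!: bdd_belowI)
    have "m < m - energy y 1 / 2" using e by simp
    then obtain T where T: "T \<ge> 0" "B T < m - energy y 1 / 2"
      unfolding m_def using bdd by (subst (asm) cInf_less_iff) auto
    \<comment> \<open>The unit of time in which \<open>\<phi> (a, - t)\<close> loses energy ends at
      \<open>- (t - 1)\<close>; the extra 1 makes it end no later than \<open>- T\<close>.\<close>
    obtain t where t: "t \<ge> T + 1" "\<phi> (a, - t) \<in> W"
      using often[OF W, of "T + 1"] by blast
    have B1: "B t = energy (\<phi> (a, - t)) 1 + B (t - 1)"
      using energy_backward_add[OF a, of "t - 1" 1] t T by (simp add: B_def)
    have "B (t - 1) \<le> B T"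
      using energy_backward_add[OF a, of T "t - 1 - T"] energy_nonpos[of "\<phi> (a, - (t - 1))" "t - 1 - T"] t T a
      by (simp add: B_def)
    then have "B t < B T + energy y 1 / 2" using B1 t(2) by (simp add: W_def)
    also have "\<dots> < m" using T by simp
    finally have "B t < m" .
    moreover have "m \<le> B t"
      unfolding m_def using t T by (intro cInf_lower[OF _ bdd]) auto
    ultimately show False by simp
  qed
next
  fix q assume "q \<in> fixed_points X \<phi>" "limitin X (\<lambda>t. \<phi> (a, - t)) q at_top"
  then show thesis
    by (intro that[of q]) (auto simp: limitin_def at_bot_mirror eventually_filtermap)
qed

section \<open>Limits of trajectory pieces\<close>

lemma flow_tube:
  assumes "openin X A" "a \<in> topspace X" "\<And>t. t \<in> {s..T} \<Longrightarrow> \<phi> (a, t) \<in> A"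
  obtains V where "openin X V" "a \<in> V" "\<And>x t. x \<in> V \<Longrightarrow> t \<in> {s..T} \<Longrightarrow> \<phi> (x, t) \<in> A"
proof -
  define O' where "O' = {z \<in> topspace (prod_topology X euclideanreal). \<phi> z \<in> A}"
  have "openin (prod_topology X euclideanreal) O'"
    unfolding O'_def by (rule openin_continuous_map_preimage[OF flow_continuous assms(1)])
  moreover have "compactin euclideanreal {s..T}" by simp
  moreover have "{a} \<times> {s..T} \<subseteq> O'" using assms by (auto simp: O'_def)
  ultimately obtain V R where "openin X V" "a \<in> V" "{s..T} \<subseteq> R" "V \<times> R \<subseteq> O'"
    using tube_lemma_right[of X euclideanreal O' "{s..T}" a] assms(2) by blast
  then show ?thesis by (intro that[of V]) (blast, blast, force simp: O'_def)
qed

text \<open>The closure of the relation ``\<open>b\<close> is on the forward trajectory of \<open>a\<close>, at an energy loss of at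
  most \<open>N\<close>''. It is not transitive: a piece ending near \<open>b\<close> and one starting near \<open>b\<close> need not
  join up.\<close>

definition reach :: "real \<Rightarrow> 'a \<Rightarrow> 'a \<Rightarrow> bool" where
  "reach N a b \<longleftrightarrow> a \<in> topspace X \<and> b \<in> topspace X \<and>
     (\<forall>V W. openin X V \<and> a \<in> V \<and> openin X W \<and> b \<in> W \<longrightarrow>
        (\<exists>x\<in>V. \<exists>t\<ge>0. \<phi> (x, t) \<in> W \<and> - N \<le> energy x t))"

lemma reachD:
  assumes "reach N a b" "openin X V" "a \<in> V" "openin X W" "b \<in> W"
  obtains x t where "x \<in> V" "t \<ge> 0" "\<phi> (x, t) \<in> W" "- N \<le> energy x t"
  using assms unfolding reach_def by blast

lemma reach_in: "reach N a b \<Longrightarrow> a \<in> topspace X" "reach N a b \<Longrightarrow> b \<in> topspace X"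
  by (auto simp: reach_def)

text \<open>The compact arc of \<open>a\<close> up to \<open>T\<close> is separated from
  \<open>b\<close>, so pieces that start near \<open>a\<close> and end near \<open>b\<close> last
  longer than \<open>T\<close>. Their loss up to \<open>T\<close> bounds that of \<open>a\<close>,
  and cutting off this initial part leaves pieces from near \<open>\<phi> (a, T)\<close> to near
  \<open>b\<close>.\<close>

lemma reach_follow:
  assumes r: "reach N a b" and "0 \<le> T" and avoid: "\<And>t. t \<in> {0..T} \<Longrightarrow> \<phi> (a, t) \<noteq> b"
  shows "- N \<le> energy a T" "reach N (\<phi> (a, T)) b"
proof -
  note ab = reach_in[OF r]
  have "compactin X ((\<lambda>t. \<phi> (a, t)) ` {0..T})"
    by (rule image_compactin[OF _ flow_orbit_continuous[OF ab(1)]]) simp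
  moreover have "compactin X {b}" using ab by simp
  moreover have "disjnt ((\<lambda>t. \<phi> (a, t)) ` {0..T}) {b}" using avoid by (force simp: disjnt_def)
  ultimately obtain A B where AB: "openin X A" "openin X B" "(\<lambda>t. \<phi> (a, t)) ` {0..T} \<subseteq> A" "{b} \<subseteq> B" "disjnt A B"
    by (rule Hausdorff_space_compact_separation[OF Hausdorff])
  obtain V' where V': "openin X V'" "a \<in> V'" "\<And>x t. x \<in> V' \<Longrightarrow> t \<in> {0..T} \<Longrightarrow> \<phi> (x, t) \<in> A"
    using flow_tube[of A a 0 T] AB ab by blast
  have late: "t > T" if "x \<in> V'" "t \<ge> 0" "\<phi> (x, t) \<in> B" for x t
    using V'(3)[OF that(1), of t] that AB(5) by (force simp: disjnt_def)
  show "- N \<le> energy a T"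
  proof (rule ccontr)
    assume "\<not> ?thesis"
    then have *: "openin X (V' \<inter> {x \<in> topspace X. energy x T < - N})" "a \<in> V' \<inter> {x \<in> topspace X. energy x T < - N}"
      using V' ab open_energy_less[OF \<open>0 \<le> T\<close>] by auto
    have "b \<in> B" using AB(4) by simp
    then obtain x t where "x \<in> V' \<inter> {x \<in> topspace X. energy x T < - N}" "t \<ge> 0" "\<phi> (x, t) \<in> B" "- N \<le> energy x t"
      by (rule reachD[OF r * AB(2)])
    then show False using late[of x t] energy_antimono[of x T t] \<open>0 \<le> T\<close> by force
  qed
  show "reach N (\<phi> (a, T)) b"
    unfolding reach_def
  proof (intro conjI allI impI)
    fix V W assume VW: "openin X V \<and> \<phi> (a, T) \<in> V \<and> openin X W \<and> b \<in> W"
    define V1 where "V1 = V' \<inter> {x \<in> topspace X. \<phi> (x, T) \<in> V}"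
    have "openin X {x \<in> topspace X. \<phi> (x, T) \<in> V}"
      using openin_continuous_map_preimage[OF flow_time_continuous] VW by blast
    then have "openin X V1" "a \<in> V1" using V' VW ab by (auto simp: V1_def)
    moreover have "openin X (W \<inter> B)" "b \<in> W \<inter> B" using VW AB by auto
    ultimately obtain x t where x: "x \<in> V1" "t \<ge> 0" "\<phi> (x, t) \<in> W \<inter> B" "- N \<le> energy x t"
      by (rule reachD[OF r])
    then have xX: "x \<in> topspace X" and "t > T" using late by (auto simp: V1_def)
    have "\<phi> (\<phi> (x, T), t - T) \<in> W" using x xX by (simp add: flow_add)
    moreover have "- N \<le> energy (\<phi> (x, T)) (t - T)"
      using energy_tail_ge[OF xX \<open>0 \<le> T\<close>, of t] x \<open>t > T\<close> by simp
    ultimately show "\<exists>x\<in>V. \<exists>t\<ge>0. \<phi> (x, t) \<in> W \<and> - N \<le> energy x t"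
      using x \<open>t > T\<close> by (intro bexI[of _ "\<phi> (x, T)"] exI[of _ "t - T"]) (auto simp: V1_def)
  qed (use ab in auto)
qed

text \<open>A trajectory that never hits \<open>b\<close> can be followed for all times at bounded
  loss, so it converges; \<open>reach\<close> is a closed relation and passes to the limit
  \<open>q\<close>.\<close>

lemma reach_forward_limit:
  assumes r: "reach N a b" and avoid: "\<And>t. 0 \<le> t \<Longrightarrow> \<phi> (a, t) \<noteq> b"
  obtains q where "q \<in> fixed_points X \<phi>" "limitin X (\<lambda>t. \<phi> (a, t)) q at_top" "reach N q b"
proof -
  note ab = reach_in[OF r]
  have f: "- N \<le> energy a T" "reach N (\<phi> (a, T)) b" if "0 \<le> T" for T
    using reach_follow[OF r that] avoid by auto
  obtain q where q: "q \<in> fixed_points X \<phi>" "limitin X (\<lambda>t. \<phi> (a, t)) q at_top"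
    using forward_limit[OF ab(1) f(1)] by blast
  have "reach N q b"
    unfolding reach_def
  proof (intro conjI allI impI)
    fix V W assume VW: "openin X V \<and> q \<in> V \<and> openin X W \<and> b \<in> W"
    then have "eventually (\<lambda>t. \<phi> (a, t) \<in> V) at_top" using q(2) by (auto simp: limitin_def)
    then obtain T where "\<And>t. t \<ge> T \<Longrightarrow> \<phi> (a, t) \<in> V"
      unfolding eventually_at_top_linorder by blast
    then have "\<phi> (a, max 0 T) \<in> V" by simp
    then show "\<exists>x\<in>V. \<exists>t\<ge>0. \<phi> (x, t) \<in> W \<and> - N \<le> energy x t"
      using reachD[OF f(2)[of "max 0 T"]] VW by (metis max.cobounded1)
  qed (use ab q fixed_in in auto)
  then show ?thesis using that q by blast
qed

text \<open>Leaving later than \<open>T\<close> is the point: the exit point has a past of length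
  \<open>T\<close> inside \<open>U\<close>, and it lies on the frontier of \<open>U\<close>, where
  exit points of different trajectories can cluster.\<close>

lemma first_exit:
  assumes x: "x \<in> topspace X" and U: "openin X U" and "0 \<le> t" "\<phi> (x, t) \<notin> U"
    and inside: "\<And>r. r \<in> {0..T} \<Longrightarrow> \<phi> (x, r) \<in> U" and "0 \<le> T"
  obtains s where "T < s" "s \<le> t" "\<phi> (x, s) \<in> X closure_of U - U" "\<And>r. 0 \<le> r \<Longrightarrow> r < s \<Longrightarrow> \<phi> (x, r) \<in> U"
proof -
  define A where "A = {r \<in> {0..t}. \<phi> (x, r) \<notin> U}"
  have "open {r. \<phi> (x, r) \<in> U}"
    using openin_continuous_map_preimage[OF flow_orbit_continuous[OF x] U] by auto
  then have "closed ({0..t} - {r. \<phi> (x, r) \<in> U})" by (intro closed_Diff) auto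
  moreover have "{0..t} - {r. \<phi> (x, r) \<in> U} = A" by (auto simp: A_def)
  ultimately have "closed A" by simp
  moreover have ne: "A \<noteq> {}" and bdd: "bdd_below A" using assms by (auto simp: A_def intro!: bdd_belowI)
  ultimately have s: "Inf A \<in> A" by (intro closed_contains_Inf)
  define s where "s = Inf A"
  have s1: "0 \<le> s" "s \<le> t" "\<phi> (x, s) \<notin> U" using s by (auto simp: s_def A_def)
  have before: "\<phi> (x, r) \<in> U" if "0 \<le> r" "r < s" for r
    using that s1 cInf_lower[OF _ bdd, of r] by (force simp: s_def A_def)
  have "T < s" using s1 inside[of s] by force
  have "\<phi> (x, s) \<in> X closure_of U"
  proof (rule ccontr)
    assume "\<phi> (x, s) \<notin> X closure_of U"
    moreover have "openin X (topspace X - X closure_of U)" by auto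
    ultimately have "open {r. \<phi> (x, r) \<in> topspace X - X closure_of U}" "\<phi> (x, s) \<in> topspace X - X closure_of U"
      using openin_continuous_map_preimage[OF flow_orbit_continuous[OF x], of "topspace X - X closure_of U"] x by auto
    then obtain d where d: "d > 0" "ball s d \<subseteq> {r. \<phi> (x, r) \<in> topspace X - X closure_of U}"
      using open_contains_ball by blast
    define r where "r = max 0 (s - d / 2)"
    have "0 \<le> r" "r < s" "r \<in> ball s d"
      using d(1) \<open>T < s\<close> \<open>0 \<le> T\<close> by (auto simp: r_def dist_real_def)
    then have "\<phi> (x, r) \<in> U" "\<phi> (x, r) \<notin> X closure_of U" using before d(2) by auto
    then show False using closure_of_subset[OF openin_subset[OF U]] by blast
  qed
  then show ?thesis using that[of s] s1 before \<open>T < s\<close> by blast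
qed

text \<open>Pieces starting ever closer to \<open>q\<close> need ever longer to leave a
  neighbourhood \<open>U\<close>. Their exit points cluster at some \<open>a\<close> on the
  frontier, whose entire past stays in the closure of \<open>U\<close> at bounded loss and hence
  converges to the only fixed point there, which is \<open>q\<close>.\<close>

lemma reach_leave:
  assumes q: "q \<in> fixed_points X \<phi>" and r: "reach N q b" and "b \<noteq> q"
  obtains a where "a \<in> topspace X - fixed_points X \<phi>" "limitin X (\<lambda>t. \<phi> (a, t)) q at_bot" "reach N a b"
proof -
  note qb = reach_in[OF r]
  \<comment> \<open>An open \<open>U'\<close> keeps \<open>b\<close> and the other fixed points away
    from the closure of \<open>U\<close>, not only from \<open>U\<close>.\<close>
  obtain U U' where U: "openin X U" "openin X U'" "q \<in> U" "insert b (fixed_points X \<phi>) - {q} \<subseteq> U'" "U \<inter> U' = {}"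
    using separate_fixed[of q "insert b (fixed_points X \<phi>) - {q}"] finite_fixed qb fixed_in by blast
  have cl: "X closure_of U \<inter> U' = {}"
    using openin_Int_closure_of_eq_empty[OF U(2), of U] U(5) by blast
  define D where "D = X closure_of U - U"
  have D: "compactin X D"
    unfolding D_def using U(1) by (intro compactin_closed closedin_diff) auto
  \<comment> \<open>Candidates for exit points, with target neighbourhood \<open>W\<close> of
    \<open>b\<close> and a past of length \<open>T\<close>. Smaller \<open>W\<close> and larger
    \<open>T\<close> give a smaller set, which makes the family directed.\<close>
  define S where "S = (\<lambda>(W, T). {y \<in> topspace X. (\<forall>s\<in>{0..T}. \<phi> (y, - s) \<in> X closure_of U) \<and>
      - N \<le> energy (\<phi> (y, - T)) T \<and> (\<exists>t\<ge>0. \<phi> (y, t) \<in> W \<and> - N \<le> energy y t)})"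
  define I where "I = {(W, T :: real). openin X W \<and> b \<in> W \<and> 0 \<le> T}"
  have mono: "S (W, T) \<subseteq> S (W', T')" if "W \<subseteq> W'" "0 \<le> T'" "T' \<le> T" for W W' T T'
  proof
    fix y assume y: "y \<in> S (W, T)"
    then have yX: "y \<in> topspace X" by (simp add: S_def)
    have "energy (\<phi> (y, - T)) T \<le> energy (\<phi> (y, - T')) T'"
      using energy_backward_add[OF yX, of T' "T - T'"] energy_nonpos[of "\<phi> (y, - T)" "T - T'"] that yX by simp
    then have "- N \<le> energy (\<phi> (y, - T')) T'" using y by (auto simp: S_def)
    then show "y \<in> S (W', T')" using y that by (fastforce simp: S_def)
  qed
  obtain a where a: "a \<in> D" "\<And>i V. i \<in> I \<Longrightarrow> openin X V \<Longrightarrow> a \<in> V \<Longrightarrow> V \<inter> S i \<noteq> {}"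
  proof (rule compact_directed_cluster_point[OF D, of I S])
    show "I \<noteq> {}" using qb by (auto simp: I_def intro!: exI[of _ "topspace X"] exI[of _ 0])
  next
    fix i j assume ij: "i \<in> I" "j \<in> I"
    then obtain W T W' T' where eq: "i = (W, T)" "j = (W', T')" by (metis surj_pair)
    have "(W \<inter> W', max T T') \<in> I" using ij by (auto simp: I_def eq)
    moreover have "S (W \<inter> W', max T T') \<subseteq> S i \<inter> S j"
      unfolding eq using ij mono[of "W \<inter> W'" W T "max T T'"] mono[of "W \<inter> W'" W' T' "max T T'"]
      by (auto simp: I_def eq)
    ultimately show "\<exists>k\<in>I. S k \<subseteq> S i \<inter> S j" by blast
  next
    fix i assume i: "i \<in> I"
    obtain W T where eq: "i = (W, T)" by (metis surj_pair)
    have W: "openin X W" "b \<in> W" and T: "0 \<le> T" using i by (auto simp: I_def eq)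
    \<comment> \<open>The trajectory of \<open>q\<close> is constant, so points near
      \<open>q\<close> stay in \<open>U\<close> up to time \<open>T\<close>.\<close>
    obtain V where V: "openin X V" "q \<in> V" "\<And>x t. x \<in> V \<Longrightarrow> t \<in> {0..T} \<Longrightarrow> \<phi> (x, t) \<in> U"
      using flow_tube[OF U(1) qb(1), of 0 T] flow_fixed[OF q] U(3) by metis
    have "openin X (W \<inter> U')" "b \<in> W \<inter> U'" using W U \<open>b \<noteq> q\<close> by auto
    then obtain x t where x: "x \<in> V" "t \<ge> 0" "\<phi> (x, t) \<in> W \<inter> U'" "- N \<le> energy x t"
      by (rule reachD[OF r V(1,2)])
    have xX: "x \<in> topspace X" using x V openin_subset by blast
    have "\<phi> (x, t) \<notin> U" using x U by blast
    then obtain s where s: "T < s" "s \<le> t" "\<phi> (x, s) \<in> D" "\<And>r. 0 \<le> r \<Longrightarrow> r < s \<Longrightarrow> \<phi> (x, r) \<in> U"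
      using first_exit[OF xX U(1) x(2), of T] V(3)[OF x(1)] T unfolding D_def by metis
    have UC: "U \<subseteq> X closure_of U" using closure_of_subset[OF openin_subset[OF U(1)]] .
    have "\<phi> (\<phi> (x, s), - r) \<in> X closure_of U" if "r \<in> {0..T}" for r
      using s(3) s(4)[of "s - r"] that s(1) xX UC by (cases "r = 0") (auto simp: flow_add D_def)
    moreover have "- N \<le> energy (\<phi> (\<phi> (x, s), - T)) T"
    proof -
      have "energy x s \<le> energy (\<phi> (x, s - T)) T"
        using energy_tail_ge[OF xX, of "s - T" s] s T by simp
      moreover have "energy x t \<le> energy x s" using energy_antimono[OF xX, of s t] s T by simp
      ultimately show ?thesis using x(4) xX by (simp add: flow_add)
    qed
    moreover have "\<exists>r\<ge>0. \<phi> (\<phi> (x, s), r) \<in> W \<and> - N \<le> energy (\<phi> (x, s)) r"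
      using x(3,4) energy_tail_ge[OF xX, of s t] s T xX
      by (intro exI[of _ "t - s"]) (auto simp: flow_add)
    ultimately have "\<phi> (x, s) \<in> S i" using xX by (auto simp: S_def eq)
    then show "S i \<inter> D \<noteq> {}" using s(3) by blast
  qed (rule that, blast+)
  have aX: "a \<in> topspace X" using a(1) closure_of_subset_topspace[of X U] by (auto simp: D_def)
  have afix: "a \<notin> fixed_points X \<phi>" using a(1) U cl by (auto simp: D_def)
  \<comment> \<open>A violation at \<open>a\<close> would persist on an open neighbourhood and make
    it disjoint from \<open>S (topspace X, s)\<close>. The bound \<open>low\<close> arises in the
    same way.\<close>
  have behind: "\<phi> (a, - s) \<in> X closure_of U" if "0 \<le> s" for s
  proof (rule ccontr)
    assume *: "\<phi> (a, - s) \<notin> X closure_of U"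
    define V where "V = {y \<in> topspace X. \<phi> (y, - s) \<in> topspace X - X closure_of U}"
    have "openin X V" unfolding V_def
      by (rule openin_continuous_map_preimage[OF flow_time_continuous]) auto
    moreover have "a \<in> V" using * aX by (simp add: V_def)
    moreover have "(topspace X, s) \<in> I" using that qb by (auto simp: I_def)
    ultimately have "V \<inter> S (topspace X, s) \<noteq> {}" using a(2) by blast
    then show False using that by (auto simp: V_def S_def)
  qed
  have low: "- N \<le> energy (\<phi> (a, - t)) t" if "0 \<le> t" for t
  proof (rule ccontr)
    assume *: "\<not> ?thesis"
    define V where "V = {y \<in> topspace X. \<phi> (y, - t) \<in> {x \<in> topspace X. energy x t < - N}}"
    have "openin X V" unfolding V_def
      by (rule openin_continuous_map_preimage[OF flow_time_continuous open_energy_less[OF that]])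
    moreover have "a \<in> V" using * aX by (simp add: V_def)
    moreover have "(topspace X, t) \<in> I" using that qb by (auto simp: I_def)
    ultimately have "V \<inter> S (topspace X, t) \<noteq> {}" using a(2) by blast
    then show False using that by (auto simp: V_def S_def)
  qed
  obtain q' where q': "q' \<in> fixed_points X \<phi>" "limitin X (\<lambda>t. \<phi> (a, t)) q' at_bot"
    using backward_limit[OF aX low] by blast
  have "q' \<in> X closure_of U"
  proof (rule limitin_closedin[OF q'(2)])
    show "\<forall>\<^sub>F t in at_bot. \<phi> (a, t) \<in> X closure_of U"
      unfolding eventually_at_bot_linorder using behind[of "- _"] by (intro exI[of _ 0]) auto
  qed auto
  then have "q' = q" using q'(1) cl U(4) by blast
  moreover have "reach N a b"
    unfolding reach_def
  proof (intro conjI allI impI)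
    fix V W assume VW: "openin X V \<and> a \<in> V \<and> openin X W \<and> b \<in> W"
    then have "V \<inter> S (W, 0) \<noteq> {}" using a(2)[of "(W, 0)" V] by (simp add: I_def)
    then show "\<exists>x\<in>V. \<exists>t\<ge>0. \<phi> (x, t) \<in> W \<and> - N \<le> energy x t" by (auto simp: S_def)
  qed (use aX qb in auto)
  ultimately show ?thesis using that[of a] aX afix q' by blast
qed

section \<open>Connecting trajectories and the exclusion of returns\<close>

definition connections :: "('a \<times> 'a) set" where
  "connections = {(p, q). p \<in> fixed_points X \<phi> \<and> q \<in> fixed_points X \<phi> \<and>
     (\<exists>a \<in> topspace X - fixed_points X \<phi>.
        limitin X (\<lambda>t. \<phi> (a, t)) p at_bot \<and> limitin X (\<lambda>t. \<phi> (a, t)) q at_top)}"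

text \<open>A closed chain of connections is a homoclinic cycle up to indexing: \<open>f\<close> and
  \<open>x\<close> run from 0, the cycle runs from 1, and \<open>f n = f 0\<close> closes
  it.\<close>

lemma acyclic_connections:
  assumes "\<not> has_homoclinic_cycle X \<phi>" shows "acyclic connections"
proof (rule ccontr)
  assume "\<not> acyclic connections"
  then obtain p where "(p, p) \<in> connections\<^sup>+" by (auto simp: acyclic_def)
  then obtain n where n: "n > 0" "(p, p) \<in> connections ^^ n" by (auto simp: trancl_power)
  then obtain f where f: "f 0 = p" "f n = p" "\<And>i. i < n \<Longrightarrow> (f i, f (Suc i)) \<in> connections"
    by (auto simp: relpow_fun_conv)
  then have "\<forall>i<n. \<exists>a \<in> topspace X - fixed_points X \<phi>.
      limitin X (\<lambda>t. \<phi> (a, t)) (f i) at_bot \<and> limitin X (\<lambda>t. \<phi> (a, t)) (f (Suc i)) at_top"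
    by (auto simp: connections_def)
  then obtain x where x: "\<And>i. i < n \<Longrightarrow> x i \<in> topspace X - fixed_points X \<phi> \<and>
      limitin X (\<lambda>t. \<phi> (x i, t)) (f i) at_bot \<and> limitin X (\<lambda>t. \<phi> (x i, t)) (f (Suc i)) at_top"
    by metis
  have "has_homoclinic_cycle X \<phi>"
    unfolding has_homoclinic_cycle_def
  proof (rule exI[of _ n], rule exI[of _ "\<lambda>i. x (i - 1)"], rule exI[of _ "\<lambda>i. f (i - 1)"], intro conjI ballI)
    show "x (i - 1) \<in> topspace X - fixed_points X \<phi>" if "i \<in> {1..n}" for i
      using x[of "i - 1"] less_imp_diff_less that n by (cases i) auto
    show "limitin X (\<lambda>t. \<phi> (x (i - 1), t)) (f (i + 1 - 1)) at_top" if "i \<in> {1..<n}" for i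
      using that x[of "i - 1"] by auto
    show "limitin X (\<lambda>t. \<phi> (x (i + 1 - 1), t)) (f (i + 1 - 1)) at_bot" if "i \<in> {1..<n}" for i
      using that x[of i] by auto
    show "limitin X (\<lambda>t. \<phi> (x (n - 1), t)) (f (1 - 1)) at_top"
      using x[of "n - 1"] n f by auto
    show "limitin X (\<lambda>t. \<phi> (x (1 - 1), t)) (f (1 - 1)) at_bot"
      using x[of 0] n by auto
  qed (use n in auto)
  then show False using assms by simp
qed

lemma limitin_orbit_shift_at_bot:
  assumes "a \<in> topspace X" "limitin X (\<lambda>t. \<phi> (a, t)) q at_bot"
  shows "limitin X (\<lambda>t. \<phi> (\<phi> (a, s), t)) q at_bot"
proof -
  have "filterlim (\<lambda>t. s + t) at_bot at_bot"
  proof (rule filterlim_at_bot[THEN iffD2], rule allI)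
    show "\<forall>\<^sub>F t in at_bot. s + t \<le> z" for z
      unfolding eventually_at_bot_linorder by (rule exI[of _ "z - s"]) auto
  qed
  then have "eventually (\<lambda>t. \<phi> (a, s + t) \<in> U) at_bot" if "openin X U" "q \<in> U" for U
    using assms(2) that by (auto simp: limitin_def filterlim_iff)
  then show ?thesis using assms by (auto simp: limitin_def flow_add)
qed

text \<open>The chain of connecting trajectories from \<open>q\<close> terminates because \<open>connections\<close> is acyclic on
  a finite set; no lower bound on the energy lost along a connection is needed.\<close>

lemma reach_chain:
  assumes "acyclic connections" "q \<in> fixed_points X \<phi>" "reach N q b"
  shows "\<exists>q'\<in>fixed_points X \<phi>. (q, q') \<in> connections\<^sup>* \<and>
    (q' = b \<or> b \<notin> fixed_points X \<phi> \<and> limitin X (\<lambda>t. \<phi> (b, t)) q' at_bot)"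
proof -
  have "connections \<subseteq> fixed_points X \<phi> \<times> fixed_points X \<phi>" by (auto simp: connections_def)
  then have "finite connections" using finite_fixed by (meson finite_SigmaI finite_subset)
  then have "wf (connections\<inverse>)" using assms(1) by (rule finite_acyclic_wf_converse)
  then show ?thesis using assms(2,3)
  proof (induction q rule: wf_induct_rule)
    case (less q)
    show ?case
    proof (cases "b = q")
      case True
      then show ?thesis using less by blast
    next
      case False
      obtain a where a: "a \<in> topspace X - fixed_points X \<phi>" "limitin X (\<lambda>t. \<phi> (a, t)) q at_bot" "reach N a b"
        using reach_leave[OF less.prems False] by blast
      \<comment> \<open>On a direct hit \<open>b\<close> is not fixed and has the same backward
        limit as \<open>a\<close>, so the chain stops at \<open>q\<close>. Otherwise the trajectory
        of \<open>a\<close> is a connection to the next break point \<open>q1\<close>.\<close>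
      show ?thesis
      proof (cases "\<exists>t\<ge>0. \<phi> (a, t) = b")
        case True
        then obtain t where t: "\<phi> (a, t) = b" by blast
        then have "b \<notin> fixed_points X \<phi>" using flow_nonfixed[OF a(1), of t] by simp
        moreover have "limitin X (\<lambda>s. \<phi> (b, s)) q at_bot"
          using limitin_orbit_shift_at_bot[OF _ a(2), of t] a(1) t by simp
        ultimately show ?thesis using less.prems by blast
      next
        case False
        then obtain q1 where q1: "q1 \<in> fixed_points X \<phi>" "limitin X (\<lambda>t. \<phi> (a, t)) q1 at_top" "reach N q1 b"
          using reach_forward_limit[OF a(3)] by blast
        then have step: "(q, q1) \<in> connections" using less.prems a by (auto simp: connections_def)
        then obtain q' where "q' \<in> fixed_points X \<phi>" "(q1, q') \<in> connections\<^sup>*"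
          "q' = b \<or> b \<notin> fixed_points X \<phi> \<and> limitin X (\<lambda>t. \<phi> (b, t)) q' at_bot"
          using less.IH[of q1] q1 by blast
        moreover from this have "(q, q') \<in> connections\<^sup>*"
          using step by (intro converse_rtrancl_into_rtrancl[of q q1])
        ultimately show ?thesis by blast
      qed
    qed
  qed
qed

text \<open>An excursion is recorded by a single point outside \<open>U\<close>. A cluster point
  \<open>y\<close> of such points satisfies both \<open>reach N p y\<close> and
  \<open>reach N y p\<close>, and the chains of connections for the two relations close up at
  \<open>p\<close>.\<close>

lemma no_return_outside:
  assumes acyclic: "acyclic connections" and p: "p \<in> fixed_points X \<phi>" and U: "openin X U" "p \<in> U"
  obtains V where "openin X V" "p \<in> V"
    "\<And>x s t. x \<in> V \<Longrightarrow> 0 \<le> s \<Longrightarrow> s \<le> t \<Longrightarrow> \<phi> (x, t) \<in> V \<Longrightarrow> - N \<le> energy x t \<Longrightarrow> \<phi> (x, s) \<in> U"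
proof -
  have "\<exists>V. openin X V \<and> p \<in> V \<and> (\<forall>x s t. x \<in> V \<and> 0 \<le> s \<and> s \<le> t \<and> \<phi> (x, t) \<in> V \<and> - N \<le> energy x t \<longrightarrow> \<phi> (x, s) \<in> U)"
  proof (rule ccontr)
    assume contra: "\<not> ?thesis"
    define S where "S V = {\<phi> (x, s) |x s. x \<in> V \<and> 0 \<le> s \<and> (\<exists>t\<ge>s. \<phi> (x, t) \<in> V \<and> - N \<le> energy x t) \<and> \<phi> (x, s) \<notin> U}" for V
    have "compactin X (topspace X - U)" using U(1) by (intro compactin_closed) auto
    then obtain y where y: "y \<in> topspace X - U"
      "\<And>V W. V \<in> {V. openin X V \<and> p \<in> V} \<Longrightarrow> openin X W \<Longrightarrow> y \<in> W \<Longrightarrow> W \<inter> S V \<noteq> {}"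
    proof (rule compact_directed_cluster_point[where S = S and I = "{V. openin X V \<and> p \<in> V}"])
      show "{V. openin X V \<and> p \<in> V} \<noteq> {}" using U by blast
      show "\<exists>k\<in>{V. openin X V \<and> p \<in> V}. S k \<subseteq> S i \<inter> S j"
        if "i \<in> {V. openin X V \<and> p \<in> V}" "j \<in> {V. openin X V \<and> p \<in> V}" for i j
        using that by (intro bexI[of _ "i \<inter> j"]) (auto simp: S_def)
      show "S V \<inter> (topspace X - U) \<noteq> {}" if V: "V \<in> {V. openin X V \<and> p \<in> V}" for V
      proof -
        obtain x s t where x: "x \<in> V" "0 \<le> s" "s \<le> t" "\<phi> (x, t) \<in> V" "- N \<le> energy x t" "\<phi> (x, s) \<notin> U"
          using contra V by blast
        then have "x \<in> topspace X" using V openin_subset by blast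
        then have "\<phi> (x, s) \<in> S V \<inter> (topspace X - U)" using x by (auto simp: S_def)
        then show ?thesis by blast
      qed
    qed auto
    have sub: "V \<subseteq> topspace X" if "openin X V" for V using that openin_subset by blast
    have py: "reach N p y"
      unfolding reach_def
    proof (intro conjI allI impI)
      fix V W assume VW: "openin X V \<and> p \<in> V \<and> openin X W \<and> y \<in> W"
      then have "W \<inter> S V \<noteq> {}" using y(2) by blast
      then obtain x s t where x: "x \<in> V" "0 \<le> s" "s \<le> t" "- N \<le> energy x t" "\<phi> (x, s) \<in> W"
        by (auto simp: S_def)
      moreover have "energy x t \<le> energy x s" using x VW sub by (intro energy_antimono) auto
      ultimately show "\<exists>x\<in>V. \<exists>t\<ge>0. \<phi> (x, t) \<in> W \<and> - N \<le> energy x t"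
        by (intro bexI[of _ x] exI[of _ s]) auto
    qed (use y p fixed_in in auto)
    have yp: "reach N y p"
      unfolding reach_def
    proof (intro conjI allI impI)
      fix W V assume VW: "openin X W \<and> y \<in> W \<and> openin X V \<and> p \<in> V"
      then have "W \<inter> S V \<noteq> {}" using y(2) by blast
      then obtain x s t where x: "x \<in> V" "0 \<le> s" "s \<le> t" "- N \<le> energy x t" "\<phi> (x, s) \<in> W" "\<phi> (x, t) \<in> V"
        by (auto simp: S_def)
      then have xX: "x \<in> topspace X" using VW sub by blast
      have "energy x t \<le> energy (\<phi> (x, s)) (t - s)" using x xX by (intro energy_tail_ge) auto
      then show "\<exists>x\<in>W. \<exists>t\<ge>0. \<phi> (x, t) \<in> V \<and> - N \<le> energy x t"
        using x xX by (intro bexI[of _ "\<phi> (x, s)"] exI[of _ "t - s"]) (auto simp: flow_add)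
    qed (use y p fixed_in in auto)
    have "y \<noteq> p" using y U by blast
    obtain q' where q': "q' \<in> fixed_points X \<phi>" "(p, q') \<in> connections\<^sup>*"
      "q' = y \<or> y \<notin> fixed_points X \<phi> \<and> limitin X (\<lambda>t. \<phi> (y, t)) q' at_bot"
      using reach_chain[OF acyclic p py] by blast
    \<comment> \<open>Since \<open>p\<close> is fixed, the chain from \<open>q\<close> ends at
      \<open>p\<close> itself.\<close>
    have to_p: "(q, p) \<in> connections\<^sup>*" if "q \<in> fixed_points X \<phi>" "reach N q p" for q
      using reach_chain[OF acyclic that] p by blast
    \<comment> \<open>The cycle has to be non-empty. If \<open>y\<close> is fixed, this comes from
      \<open>y \<noteq> p\<close>; otherwise the trajectory of \<open>y\<close> is itself a
      connection in the middle of the chain.\<close>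
    have "(p, p) \<in> connections\<^sup>+"
    proof (cases "q' = y")
      case True
      then have "(y, p) \<in> connections\<^sup>*" using to_p yp q' by blast
      moreover have "(p, y) \<in> connections\<^sup>+"
        using q'(2) True \<open>y \<noteq> p\<close> by (metis rtranclD)
      ultimately show ?thesis by simp
    next
      case False
      then have nf: "y \<in> topspace X - fixed_points X \<phi>" and lim: "limitin X (\<lambda>t. \<phi> (y, t)) q' at_bot"
        using q' y by auto
      have "\<phi> (y, t) \<noteq> p" for t using flow_nonfixed[OF nf, of t] p by auto
      then obtain q where q: "q \<in> fixed_points X \<phi>" "limitin X (\<lambda>t. \<phi> (y, t)) q at_top" "reach N q p"
        using reach_forward_limit[OF yp] by blast
      then have "(q', q) \<in> connections" using nf lim q' by (auto simp: connections_def)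
      then show ?thesis using q'(2) to_p[OF q(1,3)] by (meson rtrancl_into_trancl1 trancl_rtrancl_trancl)
    qed
    then show False using acyclic by (auto simp: acyclic_def)
  qed
  then show ?thesis using that by blast
qed

end

section \<open>Covers from the flow\<close>

text \<open>An average of visiting times need not be a visiting time, but it lies between two of
  them, and this is the form in which \<open>no_return_outside\<close> applies.\<close>

lemma weighted_mean_bounds:
  fixes g t :: "'b \<Rightarrow> real"
  assumes "finite B" "B \<noteq> {}" and pos: "\<And>x. x \<in> B \<Longrightarrow> g x > 0"
  shows "\<exists>x\<in>B. t x \<le> (\<Sum>x\<in>B. g x * t x) / (\<Sum>x\<in>B. g x)"
    and "\<exists>x\<in>B. (\<Sum>x\<in>B. g x * t x) / (\<Sum>x\<in>B. g x) \<le> t x"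
proof -
  have s: "(\<Sum>x\<in>B. g x) > 0" using assms by (intro sum_pos)
  have "Min (t ` B) \<in> t ` B" "Max (t ` B) \<in> t ` B" using assms by auto
  then obtain a b where a: "a \<in> B" "t a = Min (t ` B)" and b: "b \<in> B" "t b = Max (t ` B)" by auto
  have "(\<Sum>x\<in>B. g x * t a) \<le> (\<Sum>x\<in>B. g x * t x)" "(\<Sum>x\<in>B. g x * t x) \<le> (\<Sum>x\<in>B. g x * t b)"
    using assms by (auto simp: a b intro!: sum_mono mult_left_mono less_imp_le[OF pos])
  then have "t a \<le> (\<Sum>x\<in>B. g x * t x) / (\<Sum>x\<in>B. g x)" "(\<Sum>x\<in>B. g x * t x) / (\<Sum>x\<in>B. g x) \<le> t b"
    using s by (auto simp: field_simps sum_distrib_left)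
  then show "\<exists>x\<in>B. t x \<le> (\<Sum>x\<in>B. g x * t x) / (\<Sum>x\<in>B. g x)"
    "\<exists>x\<in>B. (\<Sum>x\<in>B. g x * t x) / (\<Sum>x\<in>B. g x) \<le> t x" using a b by blast+
qed

text \<open>Only the end of the deformation has to lie in \<open>U\<close>; before that it may move
  through all of \<open>X\<close>. This serves both for the flow over averaged times and for the
  radial push in a cell.\<close>

lemma null_homotopic_in_deformable:
  fixes H :: "real \<times> 'a \<Rightarrow> 'a"
  assumes H: "continuous_map (prod_topology (top_of_set {0..1}) (subtopology X G)) X H"
    and H0: "\<And>x. x \<in> topspace X \<inter> G \<Longrightarrow> H (0, x) = x"
    and H1: "\<And>x. x \<in> topspace X \<inter> G \<Longrightarrow> H (1, x) \<in> U"
    and U: "null_homotopic_in X U"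
  shows "null_homotopic_in X G"
proof -
  obtain c where c: "homotopic_with (\<lambda>h. True) (subtopology X U) X id (\<lambda>x. c)"
    using U unfolding null_homotopic_in_def by blast
  have "continuous_map (subtopology X G) X (H \<circ> Pair 1)"
    by (rule continuous_map_o_Pair[OF H]) auto
  then have H1c: "continuous_map (subtopology X G) (subtopology X U) (\<lambda>x. H (1, x))"
    using H1 by (auto simp: continuous_map_in_subtopology o_def)
  have "homotopic_with (\<lambda>h. True) (subtopology X G) X id (\<lambda>x. H (1, x))"
    by (subst homotopic_with) (use H H0 in auto)
  moreover have "homotopic_with (\<lambda>h. True) (subtopology X G) X (id \<circ> (\<lambda>x. H (1, x))) ((\<lambda>x. c) \<circ> (\<lambda>x. H (1, x)))"
    by (rule homotopic_with_compose_continuous_map_right[OF c H1c]) simp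
  ultimately have "homotopic_with (\<lambda>h. True) (subtopology X G) X id (\<lambda>x. c)"
    unfolding o_def id_def by (rule homotopic_with_trans)
  then show ?thesis unfolding null_homotopic_in_def by blast
qed

context gradient_flow
begin

lemma flow_along_continuous:
  assumes "continuous_map (subtopology X G) euclideanreal \<tau>"
  shows "continuous_map (prod_topology (top_of_set {0..1}) (subtopology X G)) X (\<lambda>(s, x). \<phi> (x, s * \<tau> x))"
proof -
  let ?P = "prod_topology (top_of_set {0..1::real}) (subtopology X G)"
  have "continuous_map ?P X snd"
    using continuous_map_snd[of "top_of_set {0..1::real}" "subtopology X G"]
    by (simp add: continuous_map_in_subtopology)
  moreover have "continuous_map ?P euclideanreal fst"
    using continuous_map_fst[of "top_of_set {0..1::real}" "subtopology X G"]
    by (simp add: continuous_map_in_subtopology)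
  moreover have "continuous_map ?P euclideanreal (\<lambda>z. \<tau> (snd z))"
    using continuous_map_compose[OF continuous_map_snd assms] by (simp add: o_def)
  ultimately have "continuous_map ?P (prod_topology X euclideanreal) (\<lambda>z. (snd z, fst z * \<tau> (snd z)))"
    by (simp add: continuous_map_pairwise o_def continuous_map_real_mult)
  from continuous_map_compose[OF this flow_continuous] show ?thesis
    by (simp add: o_def case_prod_unfold)
qed

text \<open>The deformation time is the unique \<open>\<tau> x\<close> at which the loss is exactly
  \<open>N\<close>. By strict monotonicity, \<open>\<tau> x < a\<close> and
  \<open>a < \<tau> x\<close> are conditions on \<open>energy x a\<close> at the given time
  \<open>a\<close>, so continuity of \<open>\<tau>\<close> reduces to continuity of the energy in
  \<open>x\<close>.\<close>

lemma deformation_of_large_drop: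
  fixes N :: real
  assumes "N > 0"
  defines "F \<equiv> {x \<in> topspace X. \<exists>t\<ge>0. energy x t < - N}"
  obtains h where "continuous_map (prod_topology (top_of_set {0..1}) (subtopology X F)) X h"
    "\<And>x. x \<in> F \<Longrightarrow> h (0, x) = x" "\<And>x. x \<in> F \<Longrightarrow> path_integral \<omega> (\<lambda>t. h (t, x)) = - N"
proof -
  \<comment> \<open>Fixed points lose no energy and so lie outside \<open>F\<close>; strict
    monotonicity is available on all of \<open>F\<close>.\<close>
  have nonfixed: "x \<in> topspace X - fixed_points X \<phi>" if "x \<in> F" for x
    using that energy_fixed \<open>N > 0\<close> by (force simp: F_def)
  have "\<exists>s>0. energy x s = - N" if xF: "x \<in> F" for x
  proof -
    obtain t where t: "x \<in> topspace X" "t \<ge> 0" "energy x t < - N" using xF by (auto simp: F_def)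
    have "\<exists>s\<ge>0. s \<le> t \<and> energy x s = - N"
      by (rule IVT2') (use t \<open>N > 0\<close> energy_continuous_time in auto)
    then obtain s where "s \<ge> 0" "energy x s = - N" by blast
    moreover have "s \<noteq> 0" using calculation t \<open>N > 0\<close> by auto
    ultimately show ?thesis by (intro exI[of _ s]) auto
  qed
  then obtain \<tau> where \<tau>: "\<And>x. x \<in> F \<Longrightarrow> \<tau> x > 0 \<and> energy x (\<tau> x) = - N" by metis
  have less_iff: "\<tau> x < a \<longleftrightarrow> energy x a < - N" "a < \<tau> x \<longleftrightarrow> - N < energy x a" if "x \<in> F" "0 \<le> a" for x a
    using energy_strict_antimono[OF nonfixed[OF that(1)], of "\<tau> x" a]
      energy_strict_antimono[OF nonfixed[OF that(1)], of a "\<tau> x"] \<tau>[OF that(1)] that(2)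
    by (cases "\<tau> x" a rule: linorder_cases; simp)+
  have FX: "F \<subseteq> topspace X" by (auto simp: F_def)
  have op: "openin (subtopology X F) {x \<in> F. energy x a < - N}"
    "openin (subtopology X F) {x \<in> F. - N < energy x a}" if "0 \<le> a" for a
  proof -
    have "openin X {x \<in> topspace X. energy x a \<in> {..< - N}}" "openin X {x \<in> topspace X. energy x a \<in> {- N<..}}"
      by (rule openin_continuous_map_preimage[OF energy_continuous_space[OF that]]; simp)+
    moreover have "{x \<in> F. energy x a < - N} = {x \<in> topspace X. energy x a \<in> {..< - N}} \<inter> F"
      "{x \<in> F. - N < energy x a} = {x \<in> topspace X. energy x a \<in> {- N<..}} \<inter> F"
      using FX by auto
    ultimately show "openin (subtopology X F) {x \<in> F. energy x a < - N}"
      "openin (subtopology X F) {x \<in> F. - N < energy x a}" by (auto simp: openin_subtopology)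
  qed
  have "continuous_map (subtopology X F) euclideanreal \<tau>"
    unfolding continuous_map_upper_lower_semicontinuous_lt
  proof (intro allI conjI)
    fix a
    have tF: "topspace (subtopology X F) = F" using FX by auto
    show "openin (subtopology X F) {x \<in> topspace (subtopology X F). \<tau> x < a}"
    proof (cases "0 \<le> a")
      case True
      then have "{x \<in> topspace (subtopology X F). \<tau> x < a} = {x \<in> F. energy x a < - N}"
        using less_iff tF by auto
      then show ?thesis using op True by simp
    next
      case False
      then have "{x \<in> topspace (subtopology X F). \<tau> x < a} = {}"
        using \<tau> tF by force
      then show ?thesis by (simp only: openin_empty)
    qed
    show "openin (subtopology X F) {x \<in> topspace (subtopology X F). a < \<tau> x}"
    proof (cases "0 \<le> a")
      case True
      then have "{x \<in> topspace (subtopology X F). a < \<tau> x} = {x \<in> F. - N < energy x a}"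
        using less_iff tF by auto
      then show ?thesis using op True by simp
    next
      case False
      then have "{x \<in> topspace (subtopology X F). a < \<tau> x} = topspace (subtopology X F)"
        using \<tau> tF by force
      then show ?thesis by (simp only: openin_topspace)
    qed
  qed
  from flow_along_continuous[OF this] show ?thesis
  proof (rule that)
    show "(\<lambda>(s, x). \<phi> (x, s * \<tau> x)) (0, x) = x" if "x \<in> F" for x
      using that FX by auto
    show "path_integral \<omega> (\<lambda>t. (\<lambda>(s, x). \<phi> (x, s * \<tau> x)) (t, x)) = - N" if "x \<in> F" for x
      using path_integral_orbit[of x "\<tau> x"] \<tau>[OF that] that FX by auto
  qed
qed

end

context compact_gradient_flow
begin

lemma bump:
  assumes "openin X S" "x \<in> S"
  obtains g where "continuous_map X euclideanreal g" "g x = 1" "\<And>y. 0 \<le> g y"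
    "\<And>y. y \<in> topspace X \<Longrightarrow> 0 < g y \<Longrightarrow> y \<in> S"
proof -
  have "completely_regular_space X"
    using compact_Hausdorff_or_regular_imp_normal_space[OF compact] Hausdorff
      normal_imp_completely_regular_space by blast
  then obtain f where f: "continuous_map X euclideanreal f" "f x = 0" "f ` (topspace X - S) \<subseteq> {1}"
    using assms unfolding completely_regular_space_alt' by blast
  \<comment> \<open>The separating function \<open>f\<close> comes without bounds, so
    \<open>1 - f\<close> is truncated at 0 to become a weight.\<close>
  show ?thesis
  proof (rule that[of "\<lambda>y. max 0 (1 - f y)"])
    show "continuous_map X euclideanreal (\<lambda>y. max 0 (1 - f y))"
      using f(1) by (intro continuous_intros) auto
    show "y \<in> S" if "y \<in> topspace X" "0 < max 0 (1 - f y)" for y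
      using f(3) that by force
  qed (use f in auto)
qed

lemma enters_near_fixed_point:
  assumes x: "x \<in> topspace X" and bounded: "\<And>t. 0 \<le> t \<Longrightarrow> - N \<le> energy x t"
    and V: "\<And>p. p \<in> fixed_points X \<phi> \<Longrightarrow> openin X (V p) \<and> p \<in> V p"
  shows "\<exists>p\<in>fixed_points X \<phi>. \<exists>t\<ge>0. \<phi> (x, t) \<in> V p"
proof -
  obtain p where p: "p \<in> fixed_points X \<phi>" "limitin X (\<lambda>t. \<phi> (x, t)) p at_top"
    using forward_limit[OF x bounded] by blast
  then have "eventually (\<lambda>t. \<phi> (x, t) \<in> V p) at_top" using V by (auto simp: limitin_def)
  then obtain T where "\<And>t. t \<ge> T \<Longrightarrow> \<phi> (x, t) \<in> V p" unfolding eventually_at_top_linorder by blast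
  then have "\<phi> (x, max 0 T) \<in> V p" by simp
  then show ?thesis using p by (meson max.cobounded1)
qed

lemma category_cover_card_fixed_points:
  assumes acyclic: "acyclic connections"
    and local: "\<And>p. p \<in> fixed_points X \<phi> \<Longrightarrow> \<exists>U. openin X U \<and> p \<in> U \<and> null_homotopic_in X U"
    and "N > 0"
  shows "category_cover X \<omega> N (card (fixed_points X \<phi>))"
proof -
  let ?Fix = "fixed_points X \<phi>"
  define F where "F = {x \<in> topspace X. \<exists>t\<ge>0. energy x t < - real N}"
  obtain U where U: "\<And>p. p \<in> ?Fix \<Longrightarrow> openin X (U p) \<and> p \<in> U p \<and> null_homotopic_in X (U p)"
    using local by metis
  \<comment> \<open>A point outside \<open>F\<close> loses at most \<open>N\<close>. The extra 1
    leaves room for nearby points, possibly in \<open>F\<close>, at which the same visiting time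
    will be used.\<close>
  have "\<exists>V. openin X V \<and> p \<in> V \<and> (\<forall>x s t. x \<in> V \<and> 0 \<le> s \<and> s \<le> t \<and> \<phi> (x, t) \<in> V \<and>
      - (real N + 1) \<le> energy x t \<longrightarrow> \<phi> (x, s) \<in> U p)" if p: "p \<in> ?Fix" for p
  proof -
    have "openin X (U p)" "p \<in> U p" using U[OF p] by auto
    from no_return_outside[OF acyclic p this, of "real N + 1"] show ?thesis by metis
  qed
  then obtain V where V: "\<And>p. p \<in> ?Fix \<Longrightarrow> openin X (V p) \<and> p \<in> V p"
    and stay: "\<And>p x s t. p \<in> ?Fix \<Longrightarrow> x \<in> V p \<Longrightarrow> 0 \<le> s \<Longrightarrow> s \<le> t \<Longrightarrow> \<phi> (x, t) \<in> V p \<Longrightarrow>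
      - (real N + 1) \<le> energy x t \<Longrightarrow> \<phi> (x, s) \<in> U p"
    by metis
  have "F = \<Union>((\<lambda>t. {x \<in> topspace X. energy x t < - real N}) ` {0..})" by (auto simp: F_def)
  moreover have "openin X \<dots>" by (rule openin_Union) (auto intro: open_energy_less)
  ultimately have F: "openin X F" by simp
  \<comment> \<open>Each \<open>x\<close> outside \<open>F\<close> contributes a time
    \<open>t\<close> of visiting some \<open>V p\<close>, valid for every point at which the bump
    \<open>g\<close> is positive.\<close>
  have "\<forall>x\<in>topspace X - F. \<exists>p t g. p \<in> ?Fix \<and> 0 \<le> t \<and> continuous_map X euclideanreal g \<and> g x = (1::real) \<and>
      (\<forall>y. 0 \<le> g y) \<and> (\<forall>y\<in>topspace X. 0 < g y \<longrightarrow> \<phi> (y, t) \<in> V p \<and> - (real N + 1) < energy y t)"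
  proof
    fix x assume x: "x \<in> topspace X - F"
    then have low: "- real N \<le> energy x t" if "0 \<le> t" for t using that by (auto simp: F_def not_less)
    obtain p t where p: "p \<in> ?Fix" "0 \<le> t" "\<phi> (x, t) \<in> V p"
      using enters_near_fixed_point[OF _ low V] x by blast
    define S where "S = {y \<in> topspace X. \<phi> (y, t) \<in> V p} \<inter> {y \<in> topspace X. energy y t \<in> {- (real N + 1)<..}}"
    have "openin X {y \<in> topspace X. \<phi> (y, t) \<in> V p}"
      using V[OF p(1)] by (intro openin_continuous_map_preimage[OF flow_time_continuous]) auto
    moreover have "openin X {y \<in> topspace X. energy y t \<in> {- (real N + 1)<..}}"
      by (rule openin_continuous_map_preimage[OF energy_continuous_space[OF p(2)]]) simp
    ultimately have "openin X S" by (auto simp: S_def)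
    moreover have "x \<in> S" using x p low[OF p(2)] by (auto simp: S_def)
    ultimately obtain g where g: "continuous_map X euclideanreal g" "g x = 1" "\<And>y. 0 \<le> g y"
      "\<And>y. y \<in> topspace X \<Longrightarrow> 0 < g y \<Longrightarrow> y \<in> S"
      using bump by metis
    show "\<exists>p t g. p \<in> ?Fix \<and> 0 \<le> t \<and> continuous_map X euclideanreal g \<and> g x = (1::real) \<and>
      (\<forall>y. 0 \<le> g y) \<and> (\<forall>y\<in>topspace X. 0 < g y \<longrightarrow> \<phi> (y, t) \<in> V p \<and> - (real N + 1) < energy y t)"
      using p(1,2) g by (intro exI[of _ p] exI[of _ t] exI[of _ g]) (auto simp: S_def)
  qed
  then obtain p t g where ptg: "\<And>x. x \<in> topspace X - F \<Longrightarrow> p x \<in> ?Fix \<and> 0 \<le> t x \<and>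
      continuous_map X euclideanreal (g x) \<and> g x x = (1::real) \<and> (\<forall>y. 0 \<le> g x y) \<and>
      (\<forall>y\<in>topspace X. 0 < g x y \<longrightarrow> \<phi> (y, t x) \<in> V (p x) \<and> - (real N + 1) < energy y (t x))"
    by metis
  define O' where "O' x = {y \<in> topspace X. g x y \<in> {0<..}}" for x
  have "\<exists>\<F>. finite \<F> \<and> \<F> \<subseteq> O' ` (topspace X - F) \<and> topspace X - F \<subseteq> \<Union>\<F>"
  proof (rule compactinD)
    show "compactin X (topspace X - F)" using F by (intro compactin_closed) auto
    show "openin X W" if W: "W \<in> O' ` (topspace X - F)" for W
    proof -
      obtain x where "x \<in> topspace X - F" "W = O' x" using W by blast
      then show ?thesis
        unfolding O'_def using ptg by (auto simp del: greaterThan_iff intro!: openin_continuous_map_preimage[of X euclideanreal "g x"])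
    qed
    show "topspace X - F \<subseteq> \<Union>(O' ` (topspace X - F))" using ptg by (force simp: O'_def)
  qed
  then obtain \<F> where \<F>: "finite \<F>" "\<F> \<subseteq> O' ` (topspace X - F)" "topspace X - F \<subseteq> \<Union>\<F>" by blast
  then obtain A where A: "A \<subseteq> topspace X - F" "finite A" "\<F> = O' ` A"
    using finite_subset_image[OF \<F>(1,2)] by blast
  \<comment> \<open>Bumps with the same target \<open>q\<close> are merged, so each fixed point
    yields one set however many bumps compactness calls for. If \<open>q\<close> is the target of
    none, the sums are empty and so is \<open>G q\<close>.\<close>
  define Ap where "Ap q = {x \<in> A. p x = q}" for q
  define sm where "sm q y = (\<Sum>x\<in>Ap q. g x y)" for q y
  define \<tau> where "\<tau> q y = (\<Sum>x\<in>Ap q. g x y * t x) / sm q y" for q y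
  define G where "G q = {y \<in> topspace X. sm q y \<in> {0<..}}" for q
  have finAp: "finite (Ap q)" for q using A by (simp add: Ap_def)
  have smc: "continuous_map X euclideanreal (sm q)" for q
    unfolding sm_def[abs_def] using ptg A finAp by (intro continuous_map_sum) (auto simp: Ap_def)
  have G: "openin X (G q)" for q
    unfolding G_def by (rule openin_continuous_map_preimage[OF smc]) simp
  have \<tau>c: "continuous_map (subtopology X (G q)) euclideanreal (\<tau> q)" for q
  proof -
    have "continuous_map X euclideanreal (\<lambda>y. \<Sum>x\<in>Ap q. g x y * t x)"
      using ptg A finAp by (intro continuous_map_sum continuous_map_real_mult) (auto simp: Ap_def)
    then show ?thesis
      unfolding \<tau>_def[abs_def]
      by (intro continuous_map_real_divide) (auto simp: G_def intro: continuous_map_from_subtopology smc)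
  qed
  have target: "\<phi> (y, \<tau> q y) \<in> U q" if q: "q \<in> ?Fix" and y: "y \<in> G q" for q y
  proof -
    \<comment> \<open>Only indices of positive weight at \<open>y\<close> matter: for these
      \<open>t x\<close> is a visiting time of \<open>y\<close>.\<close>
    define B where "B = {x \<in> Ap q. 0 < g x y}"
    have yX: "y \<in> topspace X" and pos: "0 < sm q y" using y by (auto simp: G_def)
    have nonneg: "0 \<le> g x y" if "x \<in> Ap q" for x using ptg A that by (auto simp: Ap_def)
    have zero: "g x y = 0" if "x \<in> Ap q - B" for x
      using nonneg[of x] that by (auto simp: B_def)
    have smB: "sm q y = (\<Sum>x\<in>B. g x y)" "(\<Sum>x\<in>Ap q. g x y * t x) = (\<Sum>x\<in>B. g x y * t x)"
      unfolding sm_def by (rule sum.mono_neutral_right; use finAp zero in \<open>auto simp: B_def\<close>)+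
    have finB: "finite B" using finAp by (auto simp: B_def)
    have neB: "B \<noteq> {}" using pos smB by force
    have posB: "g x y > 0" if "x \<in> B" for x using that by (simp add: B_def)
    have \<tau>B: "\<tau> q y = (\<Sum>x\<in>B. g x y * t x) / (\<Sum>x\<in>B. g x y)"
      by (simp only: \<tau>_def smB)
    have "\<exists>a\<in>B. t a \<le> \<tau> q y" "\<exists>b\<in>B. \<tau> q y \<le> t b"
      unfolding \<tau>B by (rule weighted_mean_bounds[of B "\<lambda>x. g x y"], fact finB, fact neB, erule posB)+
    then obtain a b where ab: "a \<in> B" "b \<in> B" "t a \<le> \<tau> q y" "\<tau> q y \<le> t b"
      by blast
    have a: "\<phi> (y, t a) \<in> V q" "0 \<le> t a" and b: "\<phi> (y, t b) \<in> V q" "- (real N + 1) < energy y (t b)"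
      using ab(1,2) ptg[of a] ptg[of b] A(1) yX by (auto simp: B_def Ap_def)
    \<comment> \<open>The piece from \<open>t a\<close> to \<open>t b\<close> starts and ends in
      \<open>V q\<close>, and it loses no more than \<open>y\<close> does up to \<open>t b\<close>;
      the averaged time falls inside it.\<close>
    have "\<phi> (\<phi> (y, t a), \<tau> q y - t a) \<in> U q"
    proof (rule stay[OF q a(1), of _ "t b - t a"])
      show "\<phi> (\<phi> (y, t a), t b - t a) \<in> V q" using b yX by (simp add: flow_add)
      show "- (real N + 1) \<le> energy (\<phi> (y, t a)) (t b - t a)"
        using energy_tail_ge[OF yX a(2), of "t b"] ab b by simp
    qed (use ab in auto)
    then show ?thesis using yX by (simp add: flow_add)
  qed
  have null: "null_homotopic_in X (G q)" if q: "q \<in> ?Fix" for q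
  proof (rule null_homotopic_in_deformable[OF flow_along_continuous[OF \<tau>c]])
    show "null_homotopic_in X (U q)" using U q by blast
  qed (use target[OF q] in auto)
  obtain e where e: "bij_betw e {1..card ?Fix} ?Fix"
    using ex_bij_betw_nat_finite_1[OF finite_fixed] by blast
  have cover: "topspace X \<subseteq> F \<union> (\<Union>q\<in>?Fix. G q)"
  proof
    fix y assume y: "y \<in> topspace X"
    show "y \<in> F \<union> (\<Union>q\<in>?Fix. G q)"
    proof (cases "y \<in> F")
      case False
      then obtain x where x: "x \<in> A" "y \<in> O' x" using \<F> A y by blast
      then have "0 < sm (p x) y"
        unfolding sm_def using finAp ptg A
        by (intro sum_pos2[of _ x]) (auto simp: Ap_def O'_def)
      then have "y \<in> G (p x)" using y by (simp add: G_def)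
      then show ?thesis using ptg x A by blast
    qed auto
  qed
  obtain h where h: "continuous_map (prod_topology (top_of_set {0..1}) (subtopology X F)) X h"
    "\<And>x. x \<in> F \<Longrightarrow> h (0, x) = x" "\<And>x. x \<in> F \<Longrightarrow> path_integral \<omega> (\<lambda>t. h (t, x)) = - real N"
    using \<open>N > 0\<close> deformation_of_large_drop[of "real N", folded F_def] by (simp only: of_nat_0_less_iff) blast
  show ?thesis
    unfolding category_cover_def
  proof (rule exI[of _ F], rule exI[of _ "\<lambda>j. G (e j)"], intro conjI)
    have "(\<Union>j\<in>{1..card ?Fix}. G (e j)) = \<Union>(G ` e ` {1..card ?Fix})"
      by (simp add: image_image)
    then have "(\<Union>j\<in>{1..card ?Fix}. G (e j)) = (\<Union>q\<in>?Fix. G q)"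
      unfolding bij_betw_imp_surj_on[OF e] .
    then show "topspace X = F \<union> (\<Union>j\<in>{1..card ?Fix}. G (e j))"
      using cover openin_subset[OF F] openin_subset[OF G] by (simp add: subset_antisym UN_least)
    show "\<forall>j\<in>{1..card ?Fix}. openin X (G (e j)) \<and> null_homotopic_in X (G (e j))"
      using G null bij_betwE[OF e] by simp
    show "\<exists>h. continuous_map (prod_topology (top_of_set {0..1}) (subtopology X F)) X h \<and>
        (\<forall>x\<in>F. h (0, x) = x \<and> path_integral \<omega> (\<lambda>t. h (t, x)) \<le> - real N)"
      using h by (intro exI[of _ h]) simp
  qed (rule F)
qed

end

section \<open>Finite CW complexes are locally contractible\<close>

definition radius :: "nat \<Rightarrow> (nat \<Rightarrow> real) \<Rightarrow> real" where
  "radius n v = sqrt (\<Sum>i<n. (v i)\<^sup>2)"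

lemma radius_nonneg [simp]: "0 \<le> radius n v"
  by (simp add: radius_def sum_nonneg)

lemma radius_scale: "0 \<le> c \<Longrightarrow> radius n (\<lambda>i. c * v i) = c * radius n v"
  by (simp add: radius_def power_mult_distrib sum_distrib_left[symmetric] real_sqrt_mult)

lemma in_disk_iff:
  "v \<in> closed_disk n \<longleftrightarrow> v \<in> topspace (Euclidean_space n) \<and> radius n v \<le> 1"
  "v \<in> open_disk n \<longleftrightarrow> v \<in> topspace (Euclidean_space n) \<and> radius n v < 1"
  "v \<in> disk_boundary n \<longleftrightarrow> v \<in> topspace (Euclidean_space n) \<and> radius n v = 1"
  by (auto simp: closed_disk_def open_disk_def disk_boundary_def radius_def)

lemma closed_disk_eq: "closed_disk n = open_disk n \<union> disk_boundary n"
  by (auto simp: in_disk_iff)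

lemma topspace_Int_disk [simp]:
  "topspace (Euclidean_space n) \<inter> closed_disk n = closed_disk n"
  "topspace (Euclidean_space n) \<inter> open_disk n = open_disk n"
  by (auto simp: in_disk_iff)

lemma continuous_map_coordinate: "continuous_map (Euclidean_space n) euclideanreal (\<lambda>v. v i)"
  unfolding Euclidean_space_def
  by (intro continuous_map_from_subtopology continuous_map_product_projection) simp

lemma continuous_map_radius: "continuous_map (Euclidean_space n) euclideanreal (radius n)"
  unfolding radius_def[abs_def]
  by (intro continuous_map_sqrt continuous_map_sum continuous_map_real_pow continuous_map_coordinate) simp

lemma continuous_map_Euclidean_space_scale:
  "\<lbrakk>continuous_map X euclideanreal c; continuous_map X (Euclidean_space n) f\<rbrakk>
    \<Longrightarrow> continuous_map X (Euclidean_space n) (\<lambda>x i. c x * f x i)"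
  unfolding Euclidean_space_def continuous_map_in_subtopology
  by (auto simp: continuous_map_componentwise_UNIV Pi_iff continuous_map_real_mult)

lemma scale_in_Euclidean_space:
  "v \<in> topspace (Euclidean_space n) \<Longrightarrow> (\<lambda>i. c * v i) \<in> topspace (Euclidean_space n)"
  by (simp add: topspace_Euclidean_space)

text \<open>Points of \<open>Euclidean_space n\<close> are infinite sequences vanishing from index
  \<open>n\<close> on, with the product topology. The disk is a closed subset of a power of
  \<open>{-1..1}\<close>, which is compact by Tychonoff's theorem.\<close>

lemma compactin_closed_disk: "compactin (Euclidean_space n) (closed_disk n)"
proof -
  have "closedin (Euclidean_space n) {v \<in> topspace (Euclidean_space n). radius n v \<in> {..1}}"
    by (rule closedin_continuous_map_preimage[OF continuous_map_radius]) simp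
  moreover have "{v \<in> topspace (Euclidean_space n). radius n v \<in> {..1}} = closed_disk n"
    by (auto simp: in_disk_iff)
  ultimately have "closedin (Euclidean_space n) (closed_disk n)" by simp
  then have closed: "closedin (powertop_real UNIV) (closed_disk n)"
    using closedin_trans_full closedin_Euclidean_space[of n]
    by (metis Euclidean_space_def topspace_Euclidean_space)
  have "compactin (powertop_real UNIV) (PiE UNIV (\<lambda>_. {-1..1}))"
    by (simp add: compactin_PiE)
  moreover have "closed_disk n \<subseteq> PiE UNIV (\<lambda>_. {-1..1})"
  proof
    fix v assume v: "v \<in> closed_disk n"
    have "v i \<in> {-1..1}" for i
    proof (cases "i < n")
      case True
      then have "(v i)\<^sup>2 \<le> (\<Sum>i<n. (v i)\<^sup>2)" by (intro member_le_sum) auto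
      also have "\<dots> \<le> 1" using v by (simp add: closed_disk_def)
      finally show ?thesis by (simp add: abs_square_le_1 abs_le_iff)
    next
      case False
      then show ?thesis using v by (simp add: closed_disk_def topspace_Euclidean_space)
    qed
    then show "v \<in> PiE UNIV (\<lambda>_. {-1..1})" by auto
  qed
  ultimately have "compactin (powertop_real UNIV) (closed_disk n)"
    using closed by (rule closed_compactin)
  then show ?thesis
    unfolding Euclidean_space_def compactin_subtopology
    by (auto simp: closed_disk_def topspace_Euclidean_space)
qed

text \<open>The neighbourhood is open relative to \<open>A\<close>, as an induction over
  subcomplexes requires, but it contracts in the ambient \<open>X\<close>, so the contraction
  survives when \<open>A\<close> grows.\<close>

definition locally_null_homotopic_in :: "'a topology \<Rightarrow> 'a set \<Rightarrow> bool" where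
  "locally_null_homotopic_in X A \<longleftrightarrow>
     (\<forall>p\<in>A. \<exists>U. openin (subtopology X A) U \<and> p \<in> U \<and> null_homotopic_in X U)"

section \<open>Attaching one cell\<close>

locale cell_attachment =
  fixes X :: "'a topology" and A :: "'a set" and n :: nat and \<Phi> :: "(nat \<Rightarrow> real) \<Rightarrow> 'a"
  assumes Hausdorff: "Hausdorff_space X" and A_closed: "closedin X A"
    and continuous: "continuous_map (subtopology (Euclidean_space n) (closed_disk n)) X \<Phi>"
    and embedding: "embedding_map (subtopology (Euclidean_space n) (open_disk n)) X \<Phi>"
    and boundary: "\<Phi> ` disk_boundary n \<subseteq> A" and disjoint: "disjnt (\<Phi> ` open_disk n) A"
begin

abbreviation "D \<equiv> closed_disk n"
abbreviation "TD \<equiv> subtopology (Euclidean_space n) (closed_disk n)"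

lemma disk_sub: "D \<subseteq> topspace (Euclidean_space n)" "open_disk n \<subseteq> D" "disk_boundary n \<subseteq> D"
  by (auto simp: in_disk_iff)

lemma TD_space: "topspace TD = D"
  by simp

lemma TD_compact: "compact_space TD"
  by (rule compact_space_subtopology[OF compactin_closed_disk])

lemma A_sub: "A \<subseteq> topspace X"
  using closedin_subset[OF A_closed] .

lemma image_sub: "\<Phi> ` D \<subseteq> topspace X"
  using continuous_map_image_subset_topspace[OF continuous] by simp

lemma image_closed: "closedin TD S \<Longrightarrow> closedin X (\<Phi> ` S)"
  by (intro compactin_imp_closedin[OF Hausdorff] image_compactin[OF _ continuous])
     (rule closedin_compact_space[OF TD_compact])

lemma union_eq: "A \<union> \<Phi> ` open_disk n = A \<union> \<Phi> ` D"
  using boundary by (auto simp: closed_disk_eq)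

lemma union_closed: "closedin X (A \<union> \<Phi> ` open_disk n)"
  unfolding union_eq
  by (intro closedin_Un A_closed image_closed) (metis TD_space closedin_topspace)

lemma injective: "inj_on \<Phi> (open_disk n)"
proof -
  have "homeomorphic_map (subtopology (Euclidean_space n) (open_disk n))
      (subtopology X (\<Phi> ` topspace (subtopology (Euclidean_space n) (open_disk n)))) \<Phi>"
    using embedding by (simp add: embedding_map_def)
  moreover have "topspace (subtopology (Euclidean_space n) (open_disk n)) = open_disk n"
    by (auto simp: in_disk_iff)
  ultimately show ?thesis using homeomorphic_imp_injective_map by fastforce
qed

lemma in_A_iff: "v \<in> D \<Longrightarrow> \<Phi> v \<in> A \<longleftrightarrow> v \<in> disk_boundary n"
  using boundary disjoint by (auto simp: closed_disk_eq disjnt_iff)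

lemma open_cell: "openin (subtopology X (A \<union> \<Phi> ` open_disk n)) (\<Phi> ` open_disk n)"
proof -
  have sub: "A \<union> \<Phi> ` open_disk n \<subseteq> topspace X" using A_sub image_sub disk_sub by blast
  have "closedin (subtopology X (A \<union> \<Phi> ` open_disk n)) A"
    using A_closed by (auto simp: closedin_closed_subtopology union_closed)
  then have "openin (subtopology X (A \<union> \<Phi> ` open_disk n)) ((A \<union> \<Phi> ` open_disk n) - A)"
    unfolding closedin_def topspace_subtopology Int_absorb1[OF sub] by blast
  moreover have "(A \<union> \<Phi> ` open_disk n) - A = \<Phi> ` open_disk n"
    using disjoint by (auto simp: disjnt_iff)
  ultimately show ?thesis by simp
qed

text \<open>The embedding provides coordinates on the open cell, in which it shrinks radially to its
  centre.\<close>

lemma null_homotopic_open_cell: "null_homotopic_in X (\<Phi> ` open_disk n)"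
proof -
  let ?E = "subtopology (Euclidean_space n) (open_disk n)"
  let ?e = "\<Phi> ` open_disk n"
  have sp: "topspace ?E = open_disk n" by (auto simp: in_disk_iff)
  have "homeomorphic_map ?E (subtopology X ?e) \<Phi>"
    using embedding unfolding embedding_map_def sp .
  then obtain g where "homeomorphic_maps ?E (subtopology X ?e) \<Phi> g"
    by (auto simp: homeomorphic_map_maps)
  then have g: "continuous_map (subtopology X ?e) ?E g" and \<Phi>g: "\<And>y. y \<in> topspace X \<inter> ?e \<Longrightarrow> \<Phi> (g y) = y"
    by (auto simp: homeomorphic_maps_def)
  define H where "H = (\<lambda>(t :: real, x). \<Phi> (\<lambda>i. (1 - t) * g x i))"
  let ?P = "prod_topology (top_of_set {0..1::real}) (subtopology X ?e)"
  have gin: "g x \<in> open_disk n" if "x \<in> topspace X \<inter> ?e" for x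
    using g that by (auto simp: continuous_map_def Pi_iff)
  have "continuous_map ?P (Euclidean_space n) (\<lambda>z. g (snd z))"
    using continuous_map_into_fulltopology[OF continuous_map_compose[OF continuous_map_snd g]]
    by (simp add: o_def)
  moreover have "continuous_map ?P euclideanreal (\<lambda>z. 1 - fst z)"
    using continuous_map_fst[of "top_of_set {0..1::real}" "subtopology X ?e"]
    by (intro continuous_map_diff) (auto simp: continuous_map_in_subtopology)
  ultimately have "continuous_map ?P (Euclidean_space n) (\<lambda>z i. (1 - fst z) * g (snd z) i)"
    by (intro continuous_map_Euclidean_space_scale)
  moreover have "(\<lambda>i. (1 - fst z) * g (snd z) i) \<in> D" if "z \<in> topspace ?P" for z
  proof -
    have z: "0 \<le> fst z" "fst z \<le> 1" "g (snd z) \<in> open_disk n" using that gin[of "snd z"] by auto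
    have "(1 - fst z) * radius n (g (snd z)) \<le> 1 * 1"
      using z by (intro mult_mono) (auto simp: in_disk_iff)
    then show ?thesis
      using z radius_scale[of "1 - fst z" n "g (snd z)"]
      by (auto simp: in_disk_iff intro!: scale_in_Euclidean_space)
  qed
  ultimately have "continuous_map ?P TD (\<lambda>z i. (1 - fst z) * g (snd z) i)"
    by (auto simp: continuous_map_in_subtopology)
  from continuous_map_compose[OF this continuous]
  have "continuous_map ?P X H" by (simp add: o_def H_def case_prod_unfold)
  then have "homotopic_with (\<lambda>h. True) (subtopology X ?e) X id (\<lambda>x. \<Phi> (\<lambda>i. 0))"
    by (subst homotopic_with) (auto intro!: exI[of _ H] simp: H_def \<Phi>g)
  then show ?thesis unfolding null_homotopic_in_def by blast
qed

text \<open>A neighbourhood \<open>U\<close> of \<open>p\<close> in \<open>A\<close> is thickened into the new cell by a collar, which is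
  pushed radially back into \<open>U\<close>.\<close>

definition collar :: "'a set \<Rightarrow> (nat \<Rightarrow> real) set" where
  "collar U = {v \<in> D. 1/2 < radius n v \<and> \<Phi> (\<lambda>i. 1 / radius n v * v i) \<in> U}"

text \<open>Straight-line homotopy from the identity to the radial projection onto the boundary:
  radius \<open>r\<close> becomes \<open>(1 - t) * r + t\<close>. Boundary points do not move, which
  makes it compatible with the identity on \<open>A\<close>.\<close>

definition push :: "real \<times> (nat \<Rightarrow> real) \<Rightarrow> nat \<Rightarrow> real" where
  "push = (\<lambda>(t, v) i. ((1 - t) + t / radius n v) * v i)"

lemma push_1: "push (1, v) = (\<lambda>i. 1 / radius n v * v i)"
  and push_0: "push (0, v) = v"
  and push_boundary: "radius n v = 1 \<Longrightarrow> push (t, v) = v"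
  by (auto simp: push_def)

lemma push_in_disk:
  assumes "v \<in> D" "0 < radius n v" "0 \<le> t" "t \<le> 1"
  shows "push (t, v) \<in> D"
proof -
  have "radius n (push (t, v)) = ((1 - t) + t / radius n v) * radius n v"
    unfolding push_def using assms by (simp add: radius_scale)
  also have "\<dots> = (1 - t) * radius n v + t" using assms by (simp add: algebra_simps)
  also have "\<dots> \<le> (1 - t) * 1 + t"
    using assms by (intro add_right_mono mult_left_mono) (auto simp: in_disk_iff)
  finally show ?thesis
    using assms by (auto simp: in_disk_iff push_def intro: scale_in_Euclidean_space)
qed

lemma projection_boundary:
  assumes "v \<in> D" "0 < radius n v"
  shows "(\<lambda>i. 1 / radius n v * v i) \<in> disk_boundary n"
proof -
  have "radius n (\<lambda>i. 1 / radius n v * v i) = 1"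
    using assms by (subst radius_scale) auto
  moreover have "(\<lambda>i. 1 / radius n v * v i) \<in> topspace (Euclidean_space n)"
    using assms by (intro scale_in_Euclidean_space) (simp add: in_disk_iff)
  ultimately show ?thesis by (simp add: in_disk_iff)
qed

lemma continuous_map_push:
  assumes "B \<subseteq> {v \<in> D. 0 < radius n v}"
  shows "continuous_map (prod_topology (top_of_set {0..1}) (subtopology (Euclidean_space n) B)) TD push"
proof -
  let ?P = "prod_topology (top_of_set {0..1::real}) (subtopology (Euclidean_space n) B)"
  have fst: "continuous_map ?P euclideanreal fst"
    using continuous_map_fst[of "top_of_set {0..1::real}" "subtopology (Euclidean_space n) B"]
    by (simp add: continuous_map_in_subtopology)
  have snd: "continuous_map ?P (Euclidean_space n) snd"
    using continuous_map_snd[of "top_of_set {0..1::real}" "subtopology (Euclidean_space n) B"]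
    by (simp add: continuous_map_in_subtopology)
  have rad: "continuous_map ?P euclideanreal (\<lambda>z. radius n (snd z))"
    using continuous_map_compose[OF snd continuous_map_radius] by (simp add: o_def)
  have "continuous_map ?P euclideanreal (\<lambda>z. (1 - fst z) + fst z / radius n (snd z))"
    by (intro continuous_map_add continuous_map_diff continuous_map_real_divide fst rad)
       (use assms in auto)
  from continuous_map_Euclidean_space_scale[OF this snd]
  have "continuous_map ?P (Euclidean_space n) push" by (simp add: push_def case_prod_unfold)
  moreover have "push z \<in> D" if "z \<in> topspace ?P" for z
    using that push_in_disk[of "snd z" "fst z"] assms by (cases z) auto
  ultimately show ?thesis by (auto simp: continuous_map_in_subtopology)
qed

context
  fixes U assumes U: "openin (subtopology X A) U"
begin

lemma U_sub: "U \<subseteq> A"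
  using openin_imp_subset[OF U] .

lemma boundary_in_collar: "v \<in> disk_boundary n \<Longrightarrow> v \<in> collar U \<longleftrightarrow> \<Phi> v \<in> U"
  using disk_sub by (auto simp: collar_def in_disk_iff)

text \<open>The collar is saturated: \<Phi> can identify distinct points of the disk only on its
  boundary, and there membership in the collar is decided by the image. Saturation allows the
  quotient map to be restricted to the collar.\<close>

lemma thickening_preimage:
  assumes "v \<in> D" shows "\<Phi> v \<in> U \<union> \<Phi> ` collar U \<longleftrightarrow> v \<in> collar U"
proof
  assume *: "\<Phi> v \<in> U \<union> \<Phi> ` collar U"
  show "v \<in> collar U"
  proof (cases "v \<in> disk_boundary n")
    case True
    then have vA: "\<Phi> v \<in> A" using in_A_iff assms by blast
    have "\<Phi> v \<in> U" if "w \<in> collar U" "\<Phi> v = \<Phi> w" for w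
    proof -
      have "w \<in> D" using that by (simp add: collar_def)
      then have "w \<in> disk_boundary n" using in_A_iff that vA by simp
      then show ?thesis using boundary_in_collar that by simp
    qed
    then show ?thesis using * True boundary_in_collar by blast
  next
    case False
    then have vo: "v \<in> open_disk n" "\<Phi> v \<notin> A" using assms in_A_iff by (auto simp: closed_disk_eq)
    then obtain w where w: "w \<in> collar U" "\<Phi> v = \<Phi> w" using * U_sub by blast
    then have "w \<in> D" "\<Phi> w \<notin> A" using vo by (auto simp: collar_def)
    then have "w \<in> open_disk n" using in_A_iff by (auto simp: closed_disk_eq)
    then have "v = w" using injective vo w by (auto dest: inj_onD)
    then show ?thesis using w by simp
  qed
qed auto

lemma thickening_Int: "(U \<union> \<Phi> ` collar U) \<inter> A = U"
proof -
  have "\<Phi> v \<in> U" if "v \<in> collar U" "\<Phi> v \<in> A" for v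
  proof -
    have "v \<in> D" using that by (simp add: collar_def)
    then have "v \<in> disk_boundary n" using that in_A_iff by blast
    then show ?thesis using that boundary_in_collar by blast
  qed
  then show ?thesis using U_sub by auto
qed

lemma collar_sub: "collar U \<subseteq> {v \<in> D. 0 < radius n v}"
  by (auto simp: collar_def)

text \<open>\<open>U\<close> is open only relative to \<open>A\<close>, so it is pulled back along
  the radial projection, whose values under \<Phi> lie in \<open>A\<close>.\<close>

lemma openin_collar: "openin TD (collar U)"
proof -
  \<comment> \<open>The bound 1/2 keeps the collar off the centre, where radial projection breaks
    down; any number strictly between 0 and 1 would do.\<close>
  define S where "S = {v \<in> topspace TD. radius n v \<in> {1/2<..}}"
  have S: "openin TD S"
    unfolding S_def
    by (rule openin_continuous_map_preimage[OF continuous_map_from_subtopology[OF continuous_map_radius]]) simp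
  have SD: "S \<subseteq> {v \<in> D. 0 < radius n v}" by (auto simp: S_def)
  then have sub: "subtopology TD S = subtopology (Euclidean_space n) S"
    by (metis (no_types, lifting) inf.absorb_iff2 mem_Collect_eq subsetI subset_iff subtopology_subtopology)
  have "continuous_map (subtopology TD S) (prod_topology (top_of_set {0..1}) (subtopology (Euclidean_space n) S)) (\<lambda>v. (1::real, v))"
    unfolding sub by (auto simp: continuous_map_pairwise o_def)
  from continuous_map_compose[OF continuous_map_compose[OF this continuous_map_push[OF SD]] continuous]
  have "continuous_map (subtopology TD S) X (\<lambda>v. \<Phi> (\<lambda>i. 1 / radius n v * v i))"
    by (simp add: o_def push_1)
  moreover have "\<Phi> (\<lambda>i. 1 / radius n v * v i) \<in> A" if "v \<in> S" for v
    using projection_boundary[of v] SD that boundary by blast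
  ultimately have c: "continuous_map (subtopology TD S) (subtopology X A) (\<lambda>v. \<Phi> (\<lambda>i. 1 / radius n v * v i))"
    by (auto simp: continuous_map_in_subtopology)
  have "{v \<in> topspace (subtopology TD S). \<Phi> (\<lambda>i. 1 / radius n v * v i) \<in> U} = collar U"
    by (auto simp: collar_def S_def in_disk_iff)
  then have "openin (subtopology TD S) (collar U)"
    using openin_continuous_map_preimage[OF c U] by simp
  then show ?thesis using S by (rule openin_trans_full)
qed

lemma thickening_sub: "U \<union> \<Phi> ` collar U \<subseteq> A \<union> \<Phi> ` D"
  using U_sub by (auto simp: collar_def)

text \<open>The complement is the union of \<open>A - U\<close> and the image of
  \<open>D - collar U\<close>. Both are closed, the second as a compact set in a Hausdorff
  space.\<close>

lemma openin_thickening: "openin (subtopology X (A \<union> \<Phi> ` open_disk n)) (U \<union> \<Phi> ` collar U)"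
proof -
  let ?U = "U \<union> \<Phi> ` collar U"
  have "closedin (subtopology X A) (A - U)"
    using U A_sub by (metis Int_absorb1 closedin_diff closedin_topspace topspace_subtopology openin_closedin_eq)
  then have "closedin X (A - U)" using A_closed by (rule closedin_trans_full)
  moreover have "closedin X (\<Phi> ` (D - collar U))"
    using openin_collar by (intro image_closed) (metis TD_space closedin_diff closedin_topspace openin_closedin_eq)
  ultimately have "closedin X ((A - U) \<union> \<Phi> ` (D - collar U))" by (rule closedin_Un)
  moreover have "(A - U) \<union> \<Phi> ` (D - collar U) = (A \<union> \<Phi> ` D) - ?U"
  proof -
    define W where "W = ?U"
    have "x \<in> W \<longleftrightarrow> x \<in> U" if "x \<in> A" for x
      using thickening_Int that unfolding W_def by blast
    moreover have "\<Phi> v \<in> W \<longleftrightarrow> v \<in> collar U" if "v \<in> D" for v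
      using thickening_preimage[OF that] unfolding W_def .
    moreover have "U \<subseteq> W" by (auto simp: W_def)
    ultimately show ?thesis unfolding W_def[symmetric] by auto
  qed
  ultimately have "closedin X ((A \<union> \<Phi> ` D) - ?U)" by simp
  then have "closedin (subtopology X (A \<union> \<Phi> ` D)) ((A \<union> \<Phi> ` D) - ?U)"
    by (auto intro: closedin_subset_topspace)
  moreover have "topspace (subtopology X (A \<union> \<Phi> ` D)) = A \<union> \<Phi> ` D"
    using A_sub image_sub by auto
  ultimately show ?thesis
    unfolding union_eq using thickening_sub
    by (simp add: openin_closedin_eq)
qed

text \<open>The homotopy is the identity on \<open>A\<close> and \<open>push\<close> on the cell.
  Its continuity is the issue, since \<Phi> need not be injective on the boundary: over the image of
  the disk it is tested after composition with \<Phi> times the identity of the unit interval, a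
  quotient map as it goes from a compact space onto a Hausdorff one. The two closed parts are then
  pasted.\<close>

lemma null_homotopic_thickening:
  assumes "null_homotopic_in X U"
  shows "null_homotopic_in X (U \<union> \<Phi> ` collar U)"
proof -
  let ?U = "U \<union> \<Phi> ` collar U"
  define g where "g = inv_into (open_disk n) \<Phi>"
  define K where "K = (\<lambda>(t :: real, x). if x \<in> A then x else \<Phi> (push (t, g x)))"
  \<comment> \<open>The formula extends from the open cell to the closed disk because
    \<open>push\<close> does not move boundary points.\<close>
  have K\<Phi>: "K (t, \<Phi> v) = \<Phi> (push (t, v))" if "v \<in> D" for t v
  proof (cases "v \<in> disk_boundary n")
    case True
    then show ?thesis using in_A_iff[OF that] push_boundary by (simp add: K_def in_disk_iff)
  next
    case False
    then have "v \<in> open_disk n" using that by (simp add: closed_disk_eq)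
    then have "g (\<Phi> v) = v" unfolding g_def using injective by (rule inv_into_f_f[rotated])
    then show ?thesis using in_A_iff[OF that] False by (simp add: K_def)
  qed
  let ?I = "top_of_set {0..1::real}"
  let ?Y = "prod_topology ?I (subtopology X ?U)"
  have Usub: "?U \<subseteq> topspace X" using thickening_sub A_sub image_sub by blast
  have snd: "continuous_map ?Y X snd"
    using continuous_map_snd[of ?I "subtopology X ?U"] by (simp add: continuous_map_in_subtopology)
  define T where "T b = {z \<in> topspace ?Y. snd z \<in> (if b then A else \<Phi> ` D)}" for b
  have T: "closedin ?Y (T b)" for b
    unfolding T_def
    by (rule closedin_continuous_map_preimage[OF snd])
       (use A_closed image_closed[of D] closedin_topspace[of TD] in \<open>auto split: if_split\<close>)
  have "continuous_map (subtopology ?Y (T True)) X snd"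
    using snd by (rule continuous_map_from_subtopology)
  then have KA: "continuous_map (subtopology ?Y (T True)) X K"
    by (rule continuous_map_eq) (auto simp: T_def K_def)
  have KD: "continuous_map (subtopology ?Y (T False)) X K"
  proof -
    let ?q = "\<lambda>z :: real \<times> (nat \<Rightarrow> real). (fst z, \<Phi> (snd z))"
    let ?Z = "prod_topology ?I (subtopology X (\<Phi> ` D))"
    have "continuous_map TD (subtopology X (\<Phi> ` D)) \<Phi>"
      using continuous by (auto simp: continuous_map_in_subtopology)
    from continuous_map_compose[OF continuous_map_snd this]
    have "continuous_map (prod_topology ?I TD) ?Z ?q"
      by (simp add: continuous_map_pairwise o_def continuous_map_fst[unfolded o_def])
    moreover have "compact_space (prod_topology ?I TD)"
      using TD_compact by (simp add: compact_space_prod_topology compact_space_subtopology)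
    moreover have "Hausdorff_space ?Z"
      using Hausdorff by (simp add: Hausdorff_space_prod_topology Hausdorff_space_subtopology)
    moreover have "?q ` topspace (prod_topology ?I TD) = topspace ?Z"
      using image_sub by (force simp: image_iff)
    ultimately have quo: "quotient_map (prod_topology ?I TD) ?Z ?q"
      by (rule continuous_imp_quotient_map)
    have "openin (subtopology X (\<Phi> ` D)) (?U \<inter> \<Phi> ` D)"
    proof -
      obtain W where W: "openin X W" "?U = W \<inter> (A \<union> \<Phi> ` open_disk n)"
        using openin_thickening by (auto simp: openin_subtopology)
      then have "?U \<inter> \<Phi> ` D = W \<inter> \<Phi> ` D" using union_eq by blast
      then show ?thesis using W(1) by (auto simp: openin_subtopology)
    qed
    then have op: "openin ?Z ({0..1} \<times> (?U \<inter> \<Phi> ` D))"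
      by (auto simp: openin_prod_Times_iff)
    \<comment> \<open>A quotient map restricts to an open set and its full preimage; the full
      preimage is given by the collar because the collar is saturated.\<close>
    have pre: "{z \<in> topspace (prod_topology ?I TD). ?q z \<in> {0..1} \<times> (?U \<inter> \<Phi> ` D)} = {0..1} \<times> collar U"
      using thickening_preimage collar_sub by fastforce
    have quo': "quotient_map (subtopology (prod_topology ?I TD) ({0..1} \<times> collar U))
        (subtopology ?Z ({0..1} \<times> (?U \<inter> \<Phi> ` D))) ?q"
      by (rule quotient_map_restriction[OF quo pre]) (use op in blast)
    have eq1: "subtopology (prod_topology ?I TD) ({0..1} \<times> collar U)
        = prod_topology ?I (subtopology (Euclidean_space n) (collar U))"
    proof -
      have "D \<inter> collar U = collar U" using collar_sub by blast
      then show ?thesis by (simp add: subtopology_Times subtopology_subtopology)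
    qed
    have eq2: "subtopology ?Z ({0..1} \<times> (?U \<inter> \<Phi> ` D)) = subtopology ?Y (T False)"
    proof -
      have sp: "topspace ?Y = {0..1} \<times> ?U" using Usub by auto
      have "{z \<in> S \<times> R. snd z \<in> Q} = S \<times> (R \<inter> Q)" for S :: "real set" and R Q :: "'a set" by auto
      then have "T False = {0..1} \<times> (?U \<inter> \<Phi> ` D)"
        by (simp only: T_def sp if_False)
      moreover have "\<Phi> ` D \<inter> (?U \<inter> \<Phi> ` D) = ?U \<inter> (?U \<inter> \<Phi> ` D)" by blast
      ultimately show ?thesis by (simp add: subtopology_Times subtopology_subtopology)
    qed
    have "continuous_map (prod_topology ?I (subtopology (Euclidean_space n) (collar U))) X (\<Phi> \<circ> push)"
      by (rule continuous_map_compose[OF continuous_map_push[OF collar_sub] continuous])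
    then have "continuous_map (prod_topology ?I (subtopology (Euclidean_space n) (collar U))) X (K \<circ> ?q)"
    proof (rule continuous_map_eq)
      fix z assume "z \<in> topspace (prod_topology ?I (subtopology (Euclidean_space n) (collar U)))"
      then have "snd z \<in> D" using collar_sub by auto
      then show "(\<Phi> \<circ> push) z = (K \<circ> ?q) z" using K\<Phi>[of "snd z" "fst z"] by simp
    qed
    then show ?thesis
      using continuous_compose_quotient_map[OF quo'[unfolded eq1 eq2]] by blast
  qed
  have Kc: "continuous_map ?Y X K"
  proof (rule pasting_lemma_closed[where I = UNIV and T = T and f = "\<lambda>_. K"])
    show "\<exists>j. j \<in> UNIV \<and> z \<in> T j \<and> K z = K z" if "z \<in> topspace ?Y" for z
    proof -
      have "snd z \<in> A \<union> \<Phi> ` D" using that thickening_sub by auto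
      then have "z \<in> T True \<or> z \<in> T False" using that by (auto simp: T_def)
      then show ?thesis by blast
    qed
    show "continuous_map (subtopology ?Y (T b)) X K" for b
      using KA KD by (cases b) auto
  qed (use T in auto)
  have cell: "\<exists>v\<in>collar U \<inter> open_disk n. x = \<Phi> v" if x: "x \<in> ?U" "x \<notin> A" for x
  proof -
    obtain v where v: "v \<in> collar U" "x = \<Phi> v" using x U_sub by blast
    then have "v \<in> D" by (simp add: collar_def)
    then show ?thesis using v x in_A_iff by (auto simp: closed_disk_eq)
  qed
  show ?thesis
  proof (rule null_homotopic_in_deformable[OF Kc _ _ assms])
    fix x assume x: "x \<in> topspace X \<inter> ?U"
    show "K (0, x) = x"
    proof (cases "x \<in> A")
      case True then show ?thesis by (simp add: K_def)
    next
      case False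
      then obtain v where "v \<in> collar U" "x = \<Phi> v" using cell x by blast
      then show ?thesis using K\<Phi>[of v 0] push_0 by (simp add: collar_def)
    qed
    show "K (1, x) \<in> U"
    proof (cases "x \<in> A")
      case True
      then show ?thesis using x thickening_Int by (auto simp: K_def)
    next
      case False
      then obtain v where "v \<in> collar U" "x = \<Phi> v" using cell x by blast
      then show ?thesis using K\<Phi>[of v 1] push_1[of v] by (simp add: collar_def)
    qed
  qed
qed

end

lemma locally_null_homotopic_in_union:
  assumes "locally_null_homotopic_in X A"
  shows "locally_null_homotopic_in X (A \<union> \<Phi> ` open_disk n)"
  unfolding locally_null_homotopic_in_def
proof
  fix p assume "p \<in> A \<union> \<Phi> ` open_disk n"
  then consider "p \<in> A" | "p \<in> \<Phi> ` open_disk n" by blast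
  then show "\<exists>U. openin (subtopology X (A \<union> \<Phi> ` open_disk n)) U \<and> p \<in> U \<and> null_homotopic_in X U"
  proof cases
    case 1
    then obtain U where U: "openin (subtopology X A) U" "p \<in> U" "null_homotopic_in X U"
      using assms unfolding locally_null_homotopic_in_def by blast
    show ?thesis
      using openin_thickening[OF U(1)] null_homotopic_thickening[OF U(1,3)] U(2) by blast
  next
    case 2
    then show ?thesis using open_cell null_homotopic_open_cell by blast
  qed
qed

end

definition cell_complex :: "'a topology \<Rightarrow> (nat \<times> ((nat \<Rightarrow> real) \<Rightarrow> 'a)) set \<Rightarrow> bool" where
  "cell_complex X C \<longleftrightarrow> finite C \<and>
     (\<forall>(n, \<Phi>) \<in> C.
        continuous_map (subtopology (Euclidean_space n) (closed_disk n)) X \<Phi> \<and>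
        embedding_map (subtopology (Euclidean_space n) (open_disk n)) X \<Phi> \<and>
        \<Phi> ` disk_boundary n \<subseteq> (\<Union>(m, \<Psi>) \<in> {c \<in> C. fst c < n}. \<Psi> ` open_disk m)) \<and>
     pairwise (\<lambda>(n, \<Phi>) (m, \<Psi>). disjnt (\<Phi> ` open_disk n) (\<Psi> ` open_disk m)) C"

text \<open>Closedness is carried along in the induction because a cell is attached to a closed
  set.\<close>

lemma cell_complex_locally_null_homotopic:
  assumes "Hausdorff_space X" "cell_complex X C"
  shows "closedin X (\<Union>(n, \<Phi>) \<in> C. \<Phi> ` open_disk n) \<and>
    locally_null_homotopic_in X (\<Union>(n, \<Phi>) \<in> C. \<Phi> ` open_disk n)"
proof -
  have "finite C" using assms(2) by (simp add: cell_complex_def)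
  then show ?thesis using assms(2)
  proof (induction C rule: finite_psubset_induct)
    case (psubset C)
    show ?case
    proof (cases "C = {}")
      case True
      then show ?thesis by (simp add: locally_null_homotopic_in_def)
    next
      case False
      \<comment> \<open>The removed cell has maximal dimension. Boundaries of the other cells lie in
        cells of strictly smaller dimension and so avoid it.\<close>
      then have "Max (fst ` C) \<in> fst ` C" using psubset.hyps by (intro Max_in) auto
      then obtain c where "c \<in> C" "Max (fst ` C) = fst c" by (rule imageE)
      moreover obtain n \<Phi> where "c = (n, \<Phi>)" by (cases c)
      ultimately have c: "(n, \<Phi>) \<in> C" "n = Max (fst ` C)" by auto
      then have max: "fst c' \<le> n" if "c' \<in> C" for c' using that psubset.hyps by simp
      define C' where "C' = C - {(n, \<Phi>)}"
      define A where "A = (\<Union>(n, \<Phi>) \<in> C'. \<Phi> ` open_disk n)"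
      have lower: "{c \<in> C. fst c < m} \<subseteq> C'" if "m \<le> n" for m
        using that by (auto simp: C'_def)
      have cells: "continuous_map (subtopology (Euclidean_space m) (closed_disk m)) X \<Psi> \<and>
          embedding_map (subtopology (Euclidean_space m) (open_disk m)) X \<Psi> \<and>
          \<Psi> ` disk_boundary m \<subseteq> (\<Union>(m, \<Psi>) \<in> {c \<in> C. fst c < m}. \<Psi> ` open_disk m)"
        if "(m, \<Psi>) \<in> C" for m \<Psi>
        using bspec[OF conjunct1[OF conjunct2[OF psubset.prems[unfolded cell_complex_def]]] that]
        by simp
      have pw: "pairwise (\<lambda>(n, \<Phi>) (m, \<Psi>). disjnt (\<Phi> ` open_disk n) (\<Psi> ` open_disk m)) C"
        using psubset.prems unfolding cell_complex_def by blast
      have "cell_complex X C'"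
        unfolding cell_complex_def
      proof (intro conjI ballI)
        show "finite C'" using psubset.hyps by (simp add: C'_def)
        show "pairwise (\<lambda>(n, \<Phi>) (m, \<Psi>). disjnt (\<Phi> ` open_disk n) (\<Psi> ` open_disk m)) C'"
          using pw by (rule pairwise_subset) (auto simp: C'_def)
        fix c' assume c': "c' \<in> C'"
        obtain m \<Psi> where eq: "c' = (m, \<Psi>)" by (metis surj_pair)
        have m: "(m, \<Psi>) \<in> C" "m \<le> n" using c' max[of c'] by (auto simp: C'_def eq)
        have "{c \<in> C. fst c < m} = {c \<in> C'. fst c < m}"
          using lower[OF m(2)] by (auto simp: C'_def)
        then show "case c' of (n, \<Phi>) \<Rightarrow>
            continuous_map (subtopology (Euclidean_space n) (closed_disk n)) X \<Phi> \<and>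
            embedding_map (subtopology (Euclidean_space n) (open_disk n)) X \<Phi> \<and>
            \<Phi> ` disk_boundary n \<subseteq> (\<Union>(m, \<Psi>) \<in> {c \<in> C'. fst c < n}. \<Psi> ` open_disk m)"
          using cells[OF m(1)] by (simp add: eq)
      qed
      moreover have "C' \<subset> C" using c by (auto simp: C'_def)
      ultimately have IH: "closedin X A" "locally_null_homotopic_in X A"
        using psubset.IH unfolding A_def by blast+
      interpret cell_attachment X A n \<Phi>
      proof
        show "\<Phi> ` disk_boundary n \<subseteq> A"
          using cells[OF c(1)] lower[of n] unfolding A_def by blast
        have "disjnt (\<Phi> ` open_disk n) (\<Psi> ` open_disk m)" if "(m, \<Psi>) \<in> C'" for m \<Psi>
          using pairwiseD[OF pw c(1), of "(m, \<Psi>)"] that by (auto simp: C'_def)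
        then show "disjnt (\<Phi> ` open_disk n) A" by (auto simp: A_def disjnt_iff)
      qed (use assms(1) IH cells[OF c(1)] in auto)
      have "(\<Union>(n, \<Phi>) \<in> C. \<Phi> ` open_disk n) = A \<union> \<Phi> ` open_disk n"
        using c(1) by (auto simp: A_def C'_def)
      then show ?thesis
        using union_closed locally_null_homotopic_in_union[OF IH(2)] by simp
    qed
  qed
qed

lemma finite_CW_complexE:
  assumes "finite_CW_complex X"
  obtains C where "cell_complex X C" "(\<Union>(n, \<Phi>) \<in> C. \<Phi> ` open_disk n) = topspace X"
  using assms unfolding finite_CW_complex_def cell_complex_def by blast

lemma finite_CW_complex_Hausdorff: "finite_CW_complex X \<Longrightarrow> Hausdorff_space X"
  by (simp add: finite_CW_complex_def)

lemma finite_CW_complex_locally_null_homotopic: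
  assumes "finite_CW_complex X" "p \<in> topspace X"
  obtains U where "openin X U" "p \<in> U" "null_homotopic_in X U"
proof -
  obtain C where C: "cell_complex X C" "(\<Union>(n, \<Phi>) \<in> C. \<Phi> ` open_disk n) = topspace X"
    using finite_CW_complexE[OF assms(1)] .
  have "locally_null_homotopic_in X (topspace X)"
    using cell_complex_locally_null_homotopic[OF finite_CW_complex_Hausdorff[OF assms(1)] C(1)] C(2) by simp
  then show ?thesis using that assms(2) unfolding locally_null_homotopic_in_def by auto
qed

lemma finite_CW_complex_compact:
  assumes "finite_CW_complex X" shows "compact_space X"
proof -
  obtain C where C: "cell_complex X C" "(\<Union>(n, \<Phi>) \<in> C. \<Phi> ` open_disk n) = topspace X"
    using finite_CW_complexE[OF assms] .
  have cont: "continuous_map (subtopology (Euclidean_space n) (closed_disk n)) X \<Phi>" if "(n, \<Phi>) \<in> C" for n \<Phi>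
    using C(1) that unfolding cell_complex_def by blast
  have cpt: "compactin X (\<Phi> ` closed_disk n)" if "(n, \<Phi>) \<in> C" for n \<Phi>
    by (rule image_compactin[OF _ cont[OF that]]) (simp add: compactin_subtopology compactin_closed_disk)
  have "compactin X (\<Union>((\<lambda>(n, \<Phi>). \<Phi> ` closed_disk n) ` C))"
    using cpt C(1) by (intro compactin_Union) (auto simp: cell_complex_def)
  moreover have "\<Union>((\<lambda>(n, \<Phi>). \<Phi> ` closed_disk n) ` C) = topspace X"
  proof
    show "\<Union>((\<lambda>(n, \<Phi>). \<Phi> ` closed_disk n) ` C) \<subseteq> topspace X"
      using compactin_subset_topspace[OF cpt] by auto
    show "topspace X \<subseteq> \<Union>((\<lambda>(n, \<Phi>). \<Phi> ` closed_disk n) ` C)"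
      unfolding C(2)[symmetric] by (force simp: closed_disk_eq)
  qed
  ultimately show ?thesis by (simp add: compact_space_def)
qed

section \<open>The bound for the category\<close>

lemma cat_le_card_fixed_points:
  assumes X: "finite_CW_complex X" and "closed_one_form X \<omega>" "represents X \<omega> \<xi>"
    and "gradient_like_flow X \<omega> \<phi>" "finite (fixed_points X \<phi>)" and no_cycle: "\<not> has_homoclinic_cycle X \<phi>"
  shows "cat X \<xi> \<le> card (fixed_points X \<phi>)"
proof -
  interpret compact_gradient_flow X \<omega> \<phi>
    by unfold_locales (use assms finite_CW_complex_compact finite_CW_complex_Hausdorff in blast)+
  have "category_cover X \<omega> N (card (fixed_points X \<phi>))" if "N > 0" for N
  proof (rule category_cover_card_fixed_points[OF acyclic_connections[OF no_cycle] _ that])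
    fix p assume "p \<in> fixed_points X \<phi>"
    then have "p \<in> topspace X" by (rule fixed_in)
    from finite_CW_complex_locally_null_homotopic[OF X this]
    show "\<exists>U. openin X U \<and> p \<in> U \<and> null_homotopic_in X U" by blast
  qed
  \<comment> \<open>\<open>cat\<close> admits any representative of \<xi>; the form that carries the
    flow is the witness.\<close>
  then show ?thesis unfolding cat_def using assms by (intro Least_le) blast
qed

text \<open>An infinite set has \<open>card\<close> 0, so having at least \<open>cat X \<xi>\<close>
  zeros is expressed by a finite subset of exactly that size.\<close>

theorem corollary1:
  fixes X :: "'a topology" and \<omega> :: "'a one_form" and \<xi> :: "'a chain set \<Rightarrow> real"
  assumes "finite_CW_complex X"
    and "closed_one_form X \<omega>"
    and "represents X \<omega> \<xi>"
  shows "(finite (zero_points X \<omega>) \<and> card (zero_points X \<omega>) < cat X \<xi> \<longrightarrow>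
            (\<forall>\<phi>. gradient_like_flow X \<omega> \<phi> \<and> fixed_points X \<phi> = zero_points X \<omega> \<longrightarrow>
                 has_homoclinic_cycle X \<phi>))
       \<and> ((\<exists>\<phi>. gradient_like_flow X \<omega> \<phi> \<and> fixed_points X \<phi> = zero_points X \<omega> \<and>
                 \<not> has_homoclinic_cycle X \<phi>) \<longrightarrow>
            (\<exists>S \<subseteq> zero_points X \<omega>. finite S \<and> card S = cat X \<xi>))"
proof -
  have bound: "cat X \<xi> \<le> card (zero_points X \<omega>)"
    if "finite (zero_points X \<omega>)" "gradient_like_flow X \<omega> \<phi>" "fixed_points X \<phi> = zero_points X \<omega>"
      "\<not> has_homoclinic_cycle X \<phi>" for \<phi>
    using cat_le_card_fixed_points[OF assms that(2) _ that(4)] that(1,3) by simp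
  have "\<exists>S\<subseteq>zero_points X \<omega>. finite S \<and> card S = cat X \<xi>"
    if "gradient_like_flow X \<omega> \<phi>" "fixed_points X \<phi> = zero_points X \<omega>"
      "\<not> has_homoclinic_cycle X \<phi>" for \<phi>
  proof (cases "finite (zero_points X \<omega>)")
    case True
    then show ?thesis using bound[OF True that] obtain_subset_with_card_n by metis
  next
    case False
    then show ?thesis using infinite_arbitrarily_large by blast
  qed
  then show ?thesis using bound by (auto simp: not_less[symmetric])
qed

end
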